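(* Let $q_+,q_-$ be parameters such that either $q_+=\frac{\epsilon}{M+N}$, $q_-=\frac{M-N}{M+N}$ with $M,N\in\{0,1,2,\dots\}$, $M+N\neq0$, $\epsilon\in\{1,-1\}$, or $q_+=0$, $-1\le q_-\le1$. Let $x=1+q_-$ and $y=2q_+$. Then the $2n$-th moment of $\mu_{q_+,q_-}$ satisfies $$m_{2n}(\mu_{q_+,q_-})=\sum_{\pi\in\mathcal P_2^{sym}(2n)}q_-^{c_-(\pi)}q_+^{l_c(\pi)}=\sum_{\pi\in\mathcal P_2(2n)}x^{c(\pi)}y^{n-c(\pi)},$$ where $\mathcal P_2(2n)$ is the set of matchings (pair partitions) of $\{1,\dots,2n\}$ and, for $\pi\in\mathcal P_2(2n)$, $c(\pi)$ is the number of cycles created by the concatenation of $\pi$ with the unique non-crossing matching $\hat\pi\in\mathcal P_2(2n)$ whose left legs coincide with the left legs of $\pi$ (i.e. the number of connected components of the graph on $\{1,\dots,2n\}$ whose edges are the pairs of $\pi$ and of $\hat\pi$).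
   Context: Convention: $0^0=1$. The left leg of a pair $\{a,b\}$ with $a<b$ is $a$, the right leg is $b$. **The measure $\mu_{q_+,q_-}$.** It is the probability measure on $\mathbb R$ for which the monic polynomials $Q_n$ given by $Q_{-1}=0$, $Q_0=1$ and $tQ_n(t)=Q_{n+1}(t)+\lambda(n)Q_{n-1}(t)$, $n\ge0$, with $\lambda(n)=1+2(n-1)q_++q_-$, are the orthogonal polynomials. If $\lambda(n_0)=0$ for some $n_0\ge1$, with $n_0$ minimal, the recursion is used only with $\lambda(1),\dots,\lambda(n_0-1)>0$ (later coefficients being regarded as $0$), and $\mu_{q_+,q_-}$ is the corresponding measure supported on the $n_0$ zeros of $Q_{n_0}$. $m_k(\mu)$ denotes the $k$-th moment. **Symmetric pair partitions and cycles.** $[\pm n]=\{\overline n,\dots,\overline1,1,\dots,n\}$, $\overline i=-i$, ordered by $\overline n<\dots<\overline1<1<\dots<n$. $\mathcal P_{1,2}^{sym}(n)$ is the set of set partitions $\pi$ of $[\pm n]$ whose blocks are pairs or singletons, with $\overline\pi=\pi$ and $\overline B\ne B$ for every pair $B\in\pi$; $\mathcal P_2^{sym}(n)$ is the subset of those with no singletons. A pair $(a,b)$, $a<b$, is positive if $b>\overline a$, otherwise negative. For $\pi\in\mathcal P_{1,2}^{sym}(n)$, $\hat\pi$ denotes the unique non-crossing partition in $\mathcal P_{1,2}^{sym}(n)$ such that: the sets of right legs of positive pairs of $\pi$ and $\hat\pi$ coincide; the sets of left legs of negative pairs of $\pi$ and $\hat\pi$ coincide; and no pair $(a,b)$ of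 $\hat\pi$ covers a singleton $\{s\}$ of $\hat\pi$ (i.e. $a<s<b$ does not occur). Consider the graph on $[\pm n]$ whose edges are the pairs of $\pi$ together with the pairs of $\hat\pi$. A closed alternating component (including the case of a pair lying in both $\pi$ and $\hat\pi$) with support $S$ contains some number $m$ of pairs of $\pi$. Either $\overline S\cap S=\emptyset$, and then this component together with its image under the bar operation is counted as one positive cycle of $\pi$, of length $m$; or $\overline S=S$, and then $m=2m'$ is even and the component is one negative cycle of $\pi$, of length $m'$. Let $\mathrm{Cyc}(\pi)$ be the set of (positive and negative) cycles, $|\sigma|$ the length of a cycle, $l_c(\pi)=\sum_{\sigma\in\mathrm{Cyc}(\pi)}(|\sigma|-1)$, and $c_-(\pi)$ the number of negative cycles. *)

theory Defs
  imports "HOL-Probability.Probability" "HOL-Computational_Algebra.Polynomial"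
begin

definition lam :: "real \<Rightarrow> real \<Rightarrow> nat \<Rightarrow> real" where
  "lam qp qm n = 1 + 2 * (real n - 1) * qp + qm"

fun Qpoly :: "real \<Rightarrow> real \<Rightarrow> nat \<Rightarrow> real poly" where
  "Qpoly qp qm 0 = 1"
| "Qpoly qp qm (Suc 0) = [:0, 1:]"
| "Qpoly qp qm (Suc (Suc n)) =
     [:0, 1:] * Qpoly qp qm (Suc n) - smult (lam qp qm (Suc n)) (Qpoly qp qm n)"

definition moment :: "real measure \<Rightarrow> nat \<Rightarrow> real" where
  "moment M k = (LINT t|M. t ^ k)"

definition orthogonal_on :: "real measure \<Rightarrow> (nat \<Rightarrow> real poly) \<Rightarrow> nat set \<Rightarrow> bool" where
  "orthogonal_on M Q I \<longleftrightarrow>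
     (\<forall>i\<in>I. \<forall>j\<in>I. i \<noteq> j \<longrightarrow> (LINT t|M. poly (Q i) t * poly (Q j) t) = 0)"

text \<open>Integrability of all powers has to be demanded separately, because the Bochner
  integral of a non-integrable function is 0. If some coefficient vanishes, the measure is carried
  by the zeros of the polynomial where this first happens; the polynomials of higher degree, which
  \<open>Qpoly\<close> defines as well, are then not used.\<close>

definition is_mu :: "real \<Rightarrow> real \<Rightarrow> real measure \<Rightarrow> bool" where
  "is_mu qp qm M \<longleftrightarrow>
     real_distribution M \<and>
     (\<forall>k. integrable M (\<lambda>t. t ^ k)) \<and>
     (if \<exists>n\<ge>1. lam qp qm n = 0
      then let n0 = (LEAST n. n \<ge> 1 \<and> lam qp qm n = 0) in
             orthogonal_on M (Qpoly qp qm) {..<n0} \<and>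
             measure M {t. poly (Qpoly qp qm n0) t = 0} = 1
      else orthogonal_on M (Qpoly qp qm) UNIV)"

definition pairs :: "'a set set \<Rightarrow> 'a set set" where
  "pairs \<pi> = {B \<in> \<pi>. card B = 2}"

definition singletons :: "'a set set \<Rightarrow> 'a set set" where
  "singletons \<pi> = {B \<in> \<pi>. card B = 1}"

abbreviation left_leg :: "'a::linorder set \<Rightarrow> 'a" where "left_leg B \<equiv> Min B"
abbreviation right_leg :: "'a::linorder set \<Rightarrow> 'a" where "right_leg B \<equiv> Max B"

definition noncrossing :: "'a::linorder set set \<Rightarrow> bool" where
  "noncrossing \<pi> \<longleftrightarrow>
     \<not> (\<exists>B\<in>\<pi>. \<exists>C\<in>\<pi>. B \<noteq> C \<and>
          (\<exists>a\<in>B. \<exists>b\<in>C. \<exists>c\<in>B. \<exists>d\<in>C. a < b \<and> b < c \<and> c < d))"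

definition adjacency :: "'a set set \<Rightarrow> ('a \<times> 'a) set" where
  "adjacency E = {(u, v). \<exists>B\<in>E. u \<in> B \<and> v \<in> B}"

definition components :: "'a set \<Rightarrow> 'a set set \<Rightarrow> 'a set set" where
  "components V E = V // {(u, v). u \<in> V \<and> v \<in> V \<and> (u, v) \<in> (adjacency E)\<^sup>*}"

definition pm :: "nat \<Rightarrow> int set" where
  "pm n = {- int n..int n} - {0}"

text \<open>The bar operation on subsets is the image under negation; note that \<open>- B\<close> would
  denote the complement.\<close>

abbreviation bar :: "int set \<Rightarrow> int set" where
  "bar B \<equiv> uminus ` B"

definition P12sym :: "nat \<Rightarrow> int set set set" where
  "P12sym n = {\<pi>. partition_on (pm n) \<pi> \<and>
                  (\<forall>B\<in>\<pi>. card B = 1 \<or> card B = 2) \<and>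
                  bar ` \<pi> = \<pi> \<and>
                  (\<forall>B\<in>pairs \<pi>. bar B \<noteq> B)}"

definition P2sym :: "nat \<Rightarrow> int set set set" where
  "P2sym n = {\<pi> \<in> P12sym n. singletons \<pi> = {}}"

definition positive :: "int set \<Rightarrow> bool" where
  "positive B \<longleftrightarrow> right_leg B > - left_leg B"

definition pos_right_legs :: "int set set \<Rightarrow> int set" where
  "pos_right_legs \<pi> = right_leg ` {B \<in> pairs \<pi>. positive B}"

definition neg_left_legs :: "int set set \<Rightarrow> int set" where
  "neg_left_legs \<pi> = left_leg ` {B \<in> pairs \<pi>. \<not> positive B}"

definition hat_sym :: "nat \<Rightarrow> int set set \<Rightarrow> int set set" where
  "hat_sym n \<pi> = (THE \<sigma>. \<sigma> \<in> P12sym n \<and> noncrossing \<sigma> \<and>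
      pos_right_legs \<sigma> = pos_right_legs \<pi> \<and>
      neg_left_legs \<sigma> = neg_left_legs \<pi> \<and>
      \<not> (\<exists>B\<in>pairs \<sigma>. \<exists>s. {s} \<in> \<sigma> \<and> left_leg B < s \<and> s < right_leg B))"

text \<open>A component is closed iff each of its points lies on a pair of \<open>\<pi>\<close> and on a pair of
  \<open>hat_sym n \<pi>\<close>; otherwise it is an open path or an isolated point.\<close>

definition closed_components :: "nat \<Rightarrow> int set set \<Rightarrow> int set set" where
  "closed_components n \<pi> =
     {S \<in> components (pm n) (pairs \<pi> \<union> pairs (hat_sym n \<pi>)).
        S \<subseteq> \<Union>(pairs \<pi>) \<and> S \<subseteq> \<Union>(pairs (hat_sym n \<pi>))}"

text \<open>A cycle is encoded as the set \<open>{S, bar S}\<close> of supports of its components: this has two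
  elements for a positive cycle and is \<open>{S}\<close> for a negative one.\<close>

definition pos_cycles :: "nat \<Rightarrow> int set set \<Rightarrow> int set set set" where
  "pos_cycles n \<pi> = {{S, bar S} | S. S \<in> closed_components n \<pi> \<and> bar S \<inter> S = {}}"

definition neg_cycles :: "nat \<Rightarrow> int set set \<Rightarrow> int set set set" where
  "neg_cycles n \<pi> = {{S} | S. S \<in> closed_components n \<pi> \<and> bar S = S}"

definition Cyc :: "nat \<Rightarrow> int set set \<Rightarrow> int set set set" where
  "Cyc n \<pi> = pos_cycles n \<pi> \<union> neg_cycles n \<pi>"

text \<open>\<open>S\<close> and \<open>bar S\<close> contain equally many pairs of \<open>\<pi>\<close>, so the image below is a singleton.\<close>

definition pairs_per_component :: "int set set \<Rightarrow> int set set \<Rightarrow> nat" where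
  "pairs_per_component \<pi> \<sigma> = the_elem ((\<lambda>S. card {B \<in> pairs \<pi>. B \<subseteq> S}) ` \<sigma>)"

definition cycle_length :: "nat \<Rightarrow> int set set \<Rightarrow> int set set \<Rightarrow> nat" where
  "cycle_length n \<pi> \<sigma> =
     (if \<sigma> \<in> neg_cycles n \<pi> then pairs_per_component \<pi> \<sigma> div 2
      else pairs_per_component \<pi> \<sigma>)"

definition l_c :: "nat \<Rightarrow> int set set \<Rightarrow> nat" where
  "l_c n \<pi> = (\<Sum>\<sigma>\<in>Cyc n \<pi>. cycle_length n \<pi> \<sigma> - 1)"

definition c_minus :: "nat \<Rightarrow> int set set \<Rightarrow> nat" where
  "c_minus n \<pi> = card (neg_cycles n \<pi>)"

definition P2 :: "nat \<Rightarrow> nat set set set" where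
  "P2 n = {\<pi>. partition_on {1..n} \<pi> \<and> (\<forall>B\<in>\<pi>. card B = 2)}"

definition hat_matching :: "nat \<Rightarrow> nat set set \<Rightarrow> nat set set" where
  "hat_matching n \<pi> =
     (THE \<sigma>. \<sigma> \<in> P2 n \<and> noncrossing \<sigma> \<and> left_leg ` \<sigma> = left_leg ` \<pi>)"

definition num_cycles :: "nat \<Rightarrow> nat set set \<Rightarrow> nat" where
  "num_cycles n \<pi> = card (components {1..n} (\<pi> \<union> hat_matching n \<pi>))"

end

theory Submission
  imports Defs
begin

text \<open>
  The monic recursion says that multiplication by \<open>t\<close> moves \<open>Q\<^sub>h\<close> up one step with weight 1 and down
  one step with weight \<open>\<lambda>(h)\<close>. Since \<open>Q\<^sub>h\<close> integrates to 0 for every \<open>h \<ge> 1\<close>, the moment is the sum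
  over words of left and right legs in which a right leg closing one of \<open>k\<close> open arcs has weight
  \<open>\<lambda>(k) = x + (k - 1) y\<close>. The same weight arises when the first right leg \<open>r\<close> of a matching is
  contracted: the non-crossing matching joins \<open>r\<close> to the last left leg \<open>p\<close> before it, and of the \<open>k\<close>
  possible partners of \<open>r\<close> exactly \<open>p\<close> closes a cycle, while each of the others leaves the number of
  cycles unchanged.

  A symmetric matching of \<open>[\<plusminus>2n]\<close> is a matching \<open>\<pi>\<close> of \<open>{1..2n}\<close> with a sign on each pair, and its graph
  is a double cover of the graph of \<open>\<pi>\<close>. Over a cycle with \<open>m\<close> pairs the cover splits, giving a positive
  cycle, for exactly half of the \<open>2\<^sup>m\<close> choices of signs, and is connected, giving a negative cycle, for
  the other half. So a cycle contributes \<open>2\<^bsup>m-1\<^esup> (1 + q\<^sub>-) q\<^sub>+\<^bsup>m-1\<^esup> = x y\<^bsup>m-1\<^esup>\<close>.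
\<close>

subsection \<open>Connected components\<close>

text \<open>The non-crossing matching depends only on the left legs. Matchings are therefore grouped
  by their set of left legs, so that one non-crossing matching serves a whole group and cycles can
  be counted by induction inside it. Contraction deletes two points, so the induction runs over
  arbitrary finite disjoint sets of left and right legs instead of \<open>{1..2 * n}\<close>. It is
  uniform in the partner \<open>l\<close> of \<open>r\<close>: all left legs up to \<open>p\<close>
  precede every right leg, so \<open>l\<close> and \<open>p\<close> may be exchanged.

  For symmetric matchings, the legs that determine the non-crossing partner are the points
  \<open>b\<close> and \<open>- b\<close>, where \<open>b\<close> is a right leg of the underlying
  matching. Signs do not move them. So the partner of every signed version of a matching is the
  same: the lift of its non-crossing matching with all signs positive. This makes the base graph
  independent of the signs, and the signs on different cycles independent of each other.

  If a coefficient vanishes, orthogonality is given only below the critical degree. Beyond it the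
  integrals vanish for another reason: the critical polynomial divides all later ones.\<close>

definition component :: "'a set \<Rightarrow> 'a set set \<Rightarrow> 'a \<Rightarrow> 'a set" where
  "component V E u = {v \<in> V. (u, v) \<in> (adjacency E)\<^sup>*}"

lemma components_eq: "components V E = component V E ` V"
  unfolding components_def quotient_def component_def by auto

lemma connected_sym: "(u, v) \<in> (adjacency E)\<^sup>* \<Longrightarrow> (v, u) \<in> (adjacency E)\<^sup>*"
proof -
  have "sym ((adjacency E)\<^sup>*)"
    by (intro sym_rtrancl) (auto simp: sym_def adjacency_def)
  then show "(u, v) \<in> (adjacency E)\<^sup>* \<Longrightarrow> (v, u) \<in> (adjacency E)\<^sup>*"
    by (rule symD)
qed

lemma adjacent_connected: "B \<in> E \<Longrightarrow> u \<in> B \<Longrightarrow> v \<in> B \<Longrightarrow> (u, v) \<in> (adjacency E)\<^sup>*"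
  by (auto simp: adjacency_def)

lemma component_self: "u \<in> V \<Longrightarrow> u \<in> component V E u"
  by (simp add: component_def)

lemma component_eqI:
  assumes "(u, v) \<in> (adjacency E)\<^sup>*" shows "component V E u = component V E v"
  using rtrancl_trans[OF assms] rtrancl_trans[OF connected_sym[OF assms]]
  unfolding component_def by blast

lemma component_eq: "v \<in> component V E u \<Longrightarrow> component V E v = component V E u"
  using component_eqI[of u v E V] by (auto simp: component_def)

lemma components_eqI: "C \<in> components V E \<Longrightarrow> u \<in> C \<Longrightarrow> C = component V E u"
  unfolding components_eq by (auto dest: component_eq)

lemma components_nonempty: "C \<in> components V E \<Longrightarrow> C \<noteq> {}"
  unfolding components_eq by (auto dest: component_self)

lemma components_subset: "C \<in> components V E \<Longrightarrow> C \<subseteq> V"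
  unfolding components_eq component_def by blast

lemma Union_components: "\<Union> (components V E) = V"
proof
  show "\<Union> (components V E) \<subseteq> V" by (auto dest: components_subset)
  show "V \<subseteq> \<Union> (components V E)" by (auto simp: components_eq intro: component_self)
qed

lemma disjoint_components: "disjoint (components V E)"
proof (rule disjointI)
  fix C D assume "C \<in> components V E" "D \<in> components V E" "C \<noteq> D"
  then show "C \<inter> D = {}" using components_eqI[of C V E] components_eqI[of D V E] by blast
qed

lemma finite_components: "finite V \<Longrightarrow> finite (components V E)"
  by (simp add: components_eq)

lemma component_cases:
  assumes "\<Union> E \<subseteq> V" "C \<in> components V E" "B \<in> E"
  shows "B \<subseteq> C \<or> B \<inter> C = {}"
proof (rule ccontr)
  assume "\<not> ?thesis"
  then obtain u v where uv: "u \<in> B" "u \<notin> C" "v \<in> B" "v \<in> C" by blast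
  then have "(v, u) \<in> (adjacency E)\<^sup>*" using adjacent_connected[OF assms(3)] by simp
  moreover have "u \<in> V" using assms uv by auto
  ultimately have "u \<in> component V E v" by (simp add: component_def)
  then show False using components_eqI[OF assms(2) uv(4)] uv by simp
qed

text \<open>The way to prove that two points are not connected: a set that no edge leaves is a union
  of components.\<close>

lemma connected_closed:
  assumes "\<And>B. B \<in> E \<Longrightarrow> B \<subseteq> D \<or> B \<inter> D = {}" and "(u, v) \<in> (adjacency E)\<^sup>*" "u \<in> D"
  shows "v \<in> D"
  using assms(2,3)
proof (induction rule: rtrancl_induct)
  case (step y z)
  then obtain B where "B \<in> E" "y \<in> B" "z \<in> B" by (auto simp: adjacency_def)
  then show ?case using assms(1)[of B] step by blast
qed simp

lemma connected_map:
  assumes "\<And>B u v. B \<in> E \<Longrightarrow> u \<in> B \<Longrightarrow> v \<in> B \<Longrightarrow> (\<rho> u, \<rho> v) \<in> (adjacency E')\<^sup>*"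
    and "(u, v) \<in> (adjacency E)\<^sup>*"
  shows "(\<rho> u, \<rho> v) \<in> (adjacency E')\<^sup>*"
  using assms(2)
proof (induction rule: rtrancl_induct)
  case (step y z)
  then obtain B where "B \<in> E" "y \<in> B" "z \<in> B" by (auto simp: adjacency_def)
  then show ?case using assms(1) step rtrancl_trans by metis
qed simp

text \<open>Edge contraction in abstract form: \<open>\<rho>\<close> moves each point along a path
  into \<open>V'\<close> and carries edges of \<open>E\<close> to paths of \<open>E'\<close>, while
  edges of \<open>E'\<close> may be subdivided or rerouted in \<open>E\<close>. So both graphs have
  the same connectivity on \<open>V'\<close>.\<close>

lemma card_components_retract:
  assumes sub: "V' \<subseteq> V"
    and maps: "\<And>u. u \<in> V \<Longrightarrow> \<rho> u \<in> V'" and id: "\<And>u. u \<in> V' \<Longrightarrow> \<rho> u = u"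
    and conn: "\<And>u. u \<in> V \<Longrightarrow> (u, \<rho> u) \<in> (adjacency E)\<^sup>*"
    and E: "\<And>B u v. B \<in> E \<Longrightarrow> u \<in> B \<Longrightarrow> v \<in> B \<Longrightarrow> (\<rho> u, \<rho> v) \<in> (adjacency E')\<^sup>*"
    and E': "\<And>B u v. B \<in> E' \<Longrightarrow> u \<in> B \<Longrightarrow> v \<in> B \<Longrightarrow> (u, v) \<in> (adjacency E)\<^sup>*"
  shows "card (components V E) = card (components V' E')"
proof -
  have iff: "(u, v) \<in> (adjacency E)\<^sup>* \<longleftrightarrow> (u, v) \<in> (adjacency E')\<^sup>*" if "u \<in> V'" "v \<in> V'" for u v
  proof
    assume "(u, v) \<in> (adjacency E)\<^sup>*"
    from connected_map[where \<rho> = \<rho>, OF E this] show "(u, v) \<in> (adjacency E')\<^sup>*"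
      using id that by simp
  next
    assume "(u, v) \<in> (adjacency E')\<^sup>*"
    from connected_map[where \<rho> = "\<lambda>x. x", OF E' this] show "(u, v) \<in> (adjacency E)\<^sup>*" .
  qed
  have eq: "component V E u \<inter> V' = component V' E' (\<rho> u)" if "u \<in> V" for u
  proof -
    have "component V E u = component V E (\<rho> u)" using conn[OF that] component_eqI by metis
    also have "\<dots> \<inter> V' = component V' E' (\<rho> u)"
      using iff maps[OF that] sub by (auto simp: component_def)
    finally show ?thesis .
  qed
  \<comment> \<open>Every component meets \<open>V'\<close>, since it contains
    \<open>\<rho> u\<close> along with \<open>u\<close>; hence it is determined by its trace on
    \<open>V'\<close>.\<close>
  have "bij_betw (\<lambda>C. C \<inter> V') (components V E) (components V' E')"
    unfolding bij_betw_def
  proof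
    show "inj_on (\<lambda>C. C \<inter> V') (components V E)"
    proof (rule inj_onI)
      fix C D assume C: "C \<in> components V E" and D: "D \<in> components V E" and i: "C \<inter> V' = D \<inter> V'"
      obtain u where u: "u \<in> V" "C = component V E u" using C by (auto simp: components_eq)
      have "\<rho> u \<in> C" using u conn maps sub by (auto simp: component_def)
      then have "\<rho> u \<in> C" "\<rho> u \<in> D" using maps u(1) i by auto
      then show "C = D" using C D components_eqI by metis
    qed
    show "(\<lambda>C. C \<inter> V') ` components V E = components V' E'"
    proof (intro equalityI subsetI)
      fix X assume "X \<in> (\<lambda>C. C \<inter> V') ` components V E"
      then show "X \<in> components V' E'" using eq maps by (auto simp: components_eq)
    next
      fix X assume "X \<in> components V' E'"
      then obtain u where u: "u \<in> V'" "X = component V' E' u" by (auto simp: components_eq)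
      then have "component V E u \<inter> V' = X" using eq[of u] id sub by auto
      then show "X \<in> (\<lambda>C. C \<inter> V') ` components V E" using u sub by (auto simp: components_eq)
    qed
  qed
  then show ?thesis by (rule bij_betw_same_card)
qed

lemma components_insert_block:
  assumes B: "B \<noteq> {}" "B \<inter> V = {}" and E: "\<Union> E \<subseteq> V"
  shows "components (B \<union> V) (insert B E) = insert B (components V E)"
proof -
  have closed: "B' \<subseteq> B \<or> B' \<inter> B = {}" "B' \<subseteq> V \<or> B' \<inter> V = {}" if "B' \<in> insert B E" for B'
    using that B E by auto
  have 1: "component (B \<union> V) (insert B E) u = B" if "u \<in> B" for u
  proof -
    have "v \<in> B" if "(u, v) \<in> (adjacency (insert B E))\<^sup>*" for v
      by (rule connected_closed[where D = B, OF _ that]) (use closed \<open>u \<in> B\<close> in auto)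
    moreover have "(u, v) \<in> (adjacency (insert B E))\<^sup>*" if "v \<in> B" for v
      using that \<open>u \<in> B\<close> by (intro adjacent_connected[of B]) auto
    ultimately show ?thesis by (auto simp: component_def)
  qed
  have 2: "component (B \<union> V) (insert B E) u = component V E u" if u: "u \<in> V" for u
  proof -
    have "v \<in> V \<and> (u, v) \<in> (adjacency E)\<^sup>*" if "(u, v) \<in> (adjacency (insert B E))\<^sup>*" for v
      using that
    proof (induction rule: rtrancl_induct)
      case (step y z)
      then obtain B' where "B' \<in> insert B E" "y \<in> B'" "z \<in> B'" by (auto simp: adjacency_def)
      moreover then have "B' \<in> E" using step B by auto
      ultimately show ?case
        using step.IH E adjacent_connected[of B' E y z] rtrancl_trans by (metis UnionI subsetD)
    qed (use u in simp)
    moreover have "(adjacency E)\<^sup>* \<subseteq> (adjacency (insert B E))\<^sup>*"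
      by (intro rtrancl_mono) (auto simp: adjacency_def)
    ultimately show ?thesis by (auto simp: component_def)
  qed
  show ?thesis unfolding components_eq image_Un using 1 2 B by auto
qed

section \<open>Partitions into pairs and the components of graphs containing them\<close>

lemma partition_on_unique: "partition_on V \<pi> \<Longrightarrow> B \<in> \<pi> \<Longrightarrow> D \<in> \<pi> \<Longrightarrow> u \<in> B \<Longrightarrow> u \<in> D \<Longrightarrow> B = D"
  using partition_onD2[of V \<pi>] by (auto simp: disjoint_def)

lemma card_matching:
  assumes "partition_on V \<pi>" "\<forall>B\<in>\<pi>. card B = 2"
  shows "card V = 2 * card \<pi>"
proof -
  have "card V = sum card \<pi>"
    using assms(1,2) card_Union_disjoint[of \<pi>]
    by (metis card.infinite partition_onD1 partition_onD2 zero_neq_numeral)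
  then show ?thesis using assms(2) by simp
qed

lemma partition_on_restrict:
  assumes \<pi>: "partition_on V \<pi>" and C: "C \<subseteq> V" and "\<And>B. B \<in> \<pi> \<Longrightarrow> B \<subseteq> C \<or> B \<inter> C = {}"
  shows "partition_on C {B \<in> \<pi>. B \<subseteq> C}"
proof (rule partition_onI)
  show "\<Union> {B \<in> \<pi>. B \<subseteq> C} = C"
    using assms partition_onD1[OF \<pi>] by blast
qed (use \<pi> in \<open>auto simp: partition_on_def disjoint_def disjnt_def\<close>)

lemma card_component_matching:
  assumes \<pi>: "partition_on V \<pi>" "\<forall>B\<in>\<pi>. card B = 2"
    and E: "\<pi> \<subseteq> E" "\<Union> E \<subseteq> V" and C: "C \<in> components V E"
  shows "card C = 2 * card {B \<in> \<pi>. B \<subseteq> C}"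
proof (rule card_matching)
  show "partition_on C {B \<in> \<pi>. B \<subseteq> C}"
    using \<pi>(1) components_subset[OF C] component_cases[OF E(2) C] E(1)
    by (intro partition_on_restrict) auto
qed (use \<pi> in auto)

text \<open>Each component contains a block, so sending a block to its component is onto. This bound
  makes truncated differences such as \<open>n - c\<close> genuine.\<close>

lemma card_components_le:
  fixes \<pi> :: "'a::linorder set set"
  assumes \<pi>: "partition_on V \<pi>" "finite V" and E: "\<pi> \<subseteq> E" "\<Union> E \<subseteq> V"
  shows "card (components V E) \<le> card \<pi>"
proof -
  have "components V E \<subseteq> (\<lambda>B. component V E (Min B)) ` \<pi>"
  proof
    fix C assume C: "C \<in> components V E"
    then obtain u where u: "u \<in> C" "u \<in> V" using components_nonempty components_subset by blast
    then obtain B where B: "B \<in> \<pi>" "u \<in> B" using partition_onD1[OF \<pi>(1)] by auto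
    then have "B \<subseteq> C" using component_cases[OF E(2) C, of B] E(1) u by blast
    moreover have "finite B" using B \<pi> partition_onD1[OF \<pi>(1)] by (metis Union_upper finite_subset)
    ultimately have "Min B \<in> C" using B(2) Min_in by blast
    then show "C \<in> (\<lambda>B. component V E (Min B)) ` \<pi>" using components_eqI[OF C] B(1) by blast
  qed
  moreover have "finite \<pi>" using \<pi> by (simp add: finite_elements)
  ultimately show ?thesis by (meson card_image_le finite_imageI card_mono le_trans)
qed

subsection \<open>Moments as weighted ballot words\<close>

text \<open>\<open>h\<close> is the number of arcs that are already open. The truncated subtraction is harmless when
  \<open>w 0 = 0\<close>: the first violation of the ballot condition then contributes a factor 0.\<close>

definition ballot_weight :: "(nat \<Rightarrow> real) \<Rightarrow> nat \<Rightarrow> nat set \<Rightarrow> nat set \<Rightarrow> real" where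
  "ballot_weight w h L R = (\<Prod>r\<in>R. w (h + card {l \<in> L. l < r} - card {s \<in> R. s < r}))"

text \<open>The condition on cardinalities says that in the end every arc is closed, including the
  \<open>h\<close> old ones.\<close>

definition ballot_sum :: "(nat \<Rightarrow> real) \<Rightarrow> nat \<Rightarrow> nat set \<Rightarrow> real" where
  "ballot_sum w h V =
     (\<Sum>L | L \<subseteq> V \<and> card L + h = card (V - L). ballot_weight w h L (V - L))"

lemma ballot_sum_empty: "ballot_sum w h {} = (if h = 0 then 1 else 0)"
proof -
  have "{L. L \<subseteq> {} \<and> card L + h = card ({} - L)} = (if h = 0 then {{}} else {})"
    by auto
  then have "ballot_sum w h {} =
      (\<Sum>L\<in>(if h = 0 then {{}} else {}). ballot_weight w h L ({} - L))"
    unfolding ballot_sum_def by (rule arg_cong)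
  then show ?thesis by (simp add: ballot_weight_def)
qed

lemma ballot_weight_insert_left:
  assumes "finite L" "\<And>u. u \<in> L \<union> R \<Longrightarrow> v < u"
  shows "ballot_weight w h (insert v L) R = ballot_weight w (Suc h) L R"
  unfolding ballot_weight_def
proof (rule prod.cong)
  fix r assume r: "r \<in> R"
  have "{l \<in> insert v L. l < r} = insert v {l \<in> L. l < r}"
    using assms(2) r by auto
  moreover have "v \<notin> L" using assms(2)[of v] by auto
  ultimately show "w (h + card {l \<in> insert v L. l < r} - card {s \<in> R. s < r}) =
      w (Suc h + card {l \<in> L. l < r} - card {s \<in> R. s < r})"
    using assms(1) by simp
qed simp

text \<open>The smallest point closes one of the \<open>h\<close> open arcs. For
  \<open>h = 0\<close> there is none to close, and both sides vanish because of
  \<open>w 0 = 0\<close>.\<close>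

lemma ballot_weight_insert_right:
  assumes "finite R" "\<And>u. u \<in> L \<union> R \<Longrightarrow> v < u" and w0: "w 0 = 0"
  shows "ballot_weight w h L (insert v R) = w h * ballot_weight w (h - 1) L R"
proof (cases "h = 0")
  case True
  have "{l \<in> L. l < v} = {}" using assms(2) by fastforce
  then have "w (h + card {l \<in> L. l < v} - card {s \<in> insert v R. s < v}) = 0"
    using w0 True by (simp only: card.empty) simp
  then have "ballot_weight w h L (insert v R) = 0"
    unfolding ballot_weight_def using assms(1) by (intro prod_zero) auto
  then show ?thesis using True w0 by simp
next
  case False
  have v: "v \<notin> R" using assms(2)[of v] by auto
  have e: "{l \<in> L. l < v} = {}" "{s \<in> insert v R. s < v} = {}"
    using assms(2) by fastforce+
  have "w (h + card {l \<in> L. l < r} - card {s \<in> insert v R. s < r}) =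
        w (h - 1 + card {l \<in> L. l < r} - card {s \<in> R. s < r})" if "r \<in> R" for r
  proof -
    have "{s \<in> insert v R. s < r} = insert v {s \<in> R. s < r}" using assms(2) that by auto
    then have "card {s \<in> insert v R. s < r} = Suc (card {s \<in> R. s < r})"
      using v assms(1) by simp
    then show ?thesis using False by simp
  qed
  moreover have "w (h + card {l \<in> L. l < v} - card {s \<in> insert v R. s < v}) = w h"
    unfolding e by simp
  ultimately show ?thesis
    unfolding ballot_weight_def using assms(1) v
    by (subst prod.insert) (auto intro!: arg_cong2[where f = "(*)"] prod.cong simp del: insert_iff)
qed

text \<open>The first letter of the word either opens an arc or closes one. The result has the form
  of the recursion for \<open>t\<close> times a polynomial \<open>Q\<close>, which is what
  identifies the two.\<close>

lemma ballot_sum_insert_Min: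
  assumes fin: "finite V" and less: "\<And>u. u \<in> V \<Longrightarrow> v < u" and w0: "w 0 = 0"
  shows "ballot_sum w h (insert v V) = ballot_sum w (Suc h) V + w h * ballot_sum w (h - 1) V"
proof -
  have v: "v \<notin> V" using less[of v] by auto
  define P where "P h = {L. L \<subseteq> V \<and> card L + h = card (V - L)}" for h
  \<comment> \<open>In \<open>X\<close> the point \<open>v\<close> is a right leg; \<open>Y\<close>
    holds the left legs other than \<open>v\<close> of the words in which \<open>v\<close> is a left
    leg.\<close>
  define X where "X = {L. L \<subseteq> V \<and> card L + h = card (insert v V - L)}"
  define Y where "Y = {L. L \<subseteq> V \<and> card (insert v L) + h = card (V - L)}"
  have fP: "finite (P h)" "finite X" "finite Y" for h
    using fin by (auto simp: P_def X_def Y_def)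
  have dec: "{L. L \<subseteq> insert v V \<and> card L + h = card (insert v V - L)} = X \<union> insert v ` Y"
    (is "?A = _")
  proof (intro equalityI subsetI)
    fix L assume L: "L \<in> ?A"
    show "L \<in> X \<union> insert v ` Y"
    proof (cases "v \<in> L")
      case True
      then have "insert v V - L = V - (L - {v})" "insert v (L - {v}) = L" using v by auto
      then have "L - {v} \<in> Y" using L by (auto simp: Y_def)
      then show ?thesis using True by (metis UnCI imageI insert_Diff)
    next
      case False
      then show ?thesis using L by (auto simp: X_def)
    qed
  next
    fix L assume "L \<in> X \<union> insert v ` Y"
    moreover have "insert v V - insert v M = V - M" if "M \<subseteq> V" for M using v by auto
    ultimately show "L \<in> ?A" by (auto simp: X_def Y_def)
  qed
  have Yeq: "Y = P (Suc h)"
  proof -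
    have "card (insert v L) = Suc (card L)" if "L \<subseteq> V" for L
      using that fin v finite_subset by (metis card_insert_disjoint subsetD)
    then show ?thesis unfolding Y_def P_def by auto
  qed
  have Xcard: "card (insert v V - L) = Suc (card (V - L))" if "L \<subseteq> V" for L
  proof -
    have "insert v V - L = insert v (V - L)" using v that by auto
    then show ?thesis using fin v by simp
  qed
  have inj: "inj_on (insert v) Y"
    using v by (auto simp: Y_def inj_on_def) 
  have disj: "X \<inter> insert v ` Y = {}" using v by (auto simp: X_def)
  have sX: "(\<Sum>L\<in>X. ballot_weight w h L (insert v V - L)) = w h * ballot_sum w (h - 1) V"
  proof -
    have "(\<Sum>L\<in>X. ballot_weight w h L (insert v V - L)) =
          (\<Sum>L\<in>X. w h * ballot_weight w (h - 1) L (V - L))"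
    proof (rule sum.cong)
      fix L assume "L \<in> X"
      then have L: "L \<subseteq> V" by (auto simp: X_def)
      then have "insert v V - L = insert v (V - L)" using v by auto
      then show "ballot_weight w h L (insert v V - L) = w h * ballot_weight w (h - 1) L (V - L)"
        using ballot_weight_insert_right[of "V - L" L v w h] fin less w0 L by auto
    qed simp
    also have "\<dots> = w h * (\<Sum>L\<in>X. ballot_weight w (h - 1) L (V - L))"
      by (simp add: sum_distrib_left)
    also have "\<dots> = w h * ballot_sum w (h - 1) V"
    \<comment> \<open>For \<open>h = 0\<close> the index \<open>h - 1\<close> is truncated and does
      not describe \<open>X\<close>, but the factor \<open>w 0\<close> removes both sums.\<close>
    proof (cases "h = 0")
      case False
      then have "X = P (h - 1)" unfolding X_def P_def using Xcard by auto
      then show ?thesis by (simp add: ballot_sum_def P_def)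
    qed (simp add: w0)
    finally show ?thesis .
  qed
  have sY: "(\<Sum>L\<in>insert v ` Y. ballot_weight w h L (insert v V - L)) = ballot_sum w (Suc h) V"
  proof -
    have "(\<Sum>L\<in>insert v ` Y. ballot_weight w h L (insert v V - L)) =
          (\<Sum>L\<in>Y. ballot_weight w h (insert v L) (insert v V - insert v L))"
      by (simp add: sum.reindex[OF inj])
    also have "\<dots> = (\<Sum>L\<in>Y. ballot_weight w (Suc h) L (V - L))"
    proof (rule sum.cong)
      fix L assume "L \<in> Y"
      then have L: "L \<subseteq> V" by (auto simp: Y_def)
      then have "insert v V - insert v L = V - L" using v by auto
      then show "ballot_weight w h (insert v L) (insert v V - insert v L) =
          ballot_weight w (Suc h) L (V - L)"
        using ballot_weight_insert_left[of L "V - L" v w h] finite_subset[OF L fin] less L by auto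
    qed simp
    finally show ?thesis by (simp add: ballot_sum_def Yeq P_def)
  qed
  show ?thesis
    unfolding ballot_sum_def[of w h "insert v V"] dec
    using sX sY fP disj by (simp add: sum.union_disjoint)
qed

text \<open>A zero coefficient decouples the recursion: the polynomial of degree
  \<open>k + 1\<close> is just \<open>t\<close> times that of degree \<open>k\<close>, and from two
  consecutive multiples all later ones follow.\<close>

lemma Qpoly_dvd_Qpoly:
  assumes "lam qp qm k = 0" "k \<ge> 1"
  shows "Qpoly qp qm k dvd Qpoly qp qm (k + i)"
proof (induction i rule: less_induct)
  case (less i)
  obtain k' where k: "k = Suc k'" using assms(2) by (cases k) auto
  consider "i = 0" | "i = 1" | j where "i = Suc (Suc j)"
    by (metis One_nat_def not0_implies_Suc)
  then show ?case
  proof cases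
    case 2
    have "Qpoly qp qm k dvd [:0, 1:] * Qpoly qp qm k" by (rule dvd_triv_right)
    then show ?thesis using 2 assms(1) k by simp
  next
    case 3
    then have "Qpoly qp qm k dvd Qpoly qp qm (k + Suc j)" "Qpoly qp qm k dvd Qpoly qp qm (k + j)"
      using less.IH[of "Suc j"] less.IH[of j] by auto
    then show ?thesis using 3 by (auto intro!: dvd_diff dvd_smult simp: dvd_mult[of _ _ "[:0, 1:]", simplified])
  qed simp
qed

lemma is_mu_integrable_poly:
  assumes "is_mu qp qm M"
  shows "integrable M (\<lambda>t. poly p t)"
proof -
  have "integrable M (\<lambda>t. t ^ k)" for k using assms by (simp add: is_mu_def)
  then show ?thesis by (simp add: poly_altdef)
qed

text \<open>Orthogonality to the constant polynomial 1. In the degenerate case and for degrees from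
  \<open>n0\<close> on, the polynomial vanishes almost everywhere, because the measure is carried by
  zeros of one of its divisors.\<close>

lemma is_mu_integral_Qpoly:
  assumes mu: "is_mu qp qm M"
  shows "(LINT t|M. poly (Qpoly qp qm h) t) = (if h = 0 then 1 else 0)"
proof -
  interpret real_distribution M using mu by (simp add: is_mu_def)
  have orth: "(LINT t|M. poly (Qpoly qp qm h) t) = 0"
    if "orthogonal_on M (Qpoly qp qm) I" "h \<in> I" "0 \<in> I" "h \<noteq> 0" for I
  proof -
    have "(LINT t|M. poly (Qpoly qp qm h) t * poly (Qpoly qp qm 0) t) = 0"
      using that unfolding orthogonal_on_def by blast
    then show ?thesis by simp
  qed
  show ?thesis
  proof (cases "h = 0")
    case True
    then show ?thesis using prob_space by simp
  next
    case h: False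
    show ?thesis
    proof (cases "\<exists>n\<ge>1. lam qp qm n = 0")
      case False
      then have "orthogonal_on M (Qpoly qp qm) UNIV" using mu by (simp add: is_mu_def)
      then show ?thesis using orth[of UNIV] h by simp
    next
      case True
      define n0 where "n0 = (LEAST n. n \<ge> 1 \<and> lam qp qm n = 0)"
      have n0: "n0 \<ge> 1" "lam qp qm n0 = 0"
        using LeastI_ex[of "\<lambda>n. n \<ge> 1 \<and> lam qp qm n = 0"] True unfolding n0_def by auto
      have M: "orthogonal_on M (Qpoly qp qm) {..<n0}"
        "measure M {t. poly (Qpoly qp qm n0) t = 0} = 1"
        using mu True unfolding is_mu_def n0_def Let_def by auto
      show ?thesis
      proof (cases "h < n0")
        case True
        then show ?thesis using orth[OF M(1)] h by simp
      next
        case False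
        then have dvd: "Qpoly qp qm n0 dvd Qpoly qp qm h"
          using Qpoly_dvd_Qpoly[OF n0(2,1), of "h - n0"] by simp
        have "AE t in M. t \<in> {t. poly (Qpoly qp qm n0) t = 0}"
          by (rule AE_prob_1[OF M(2)])
        then have "AE t in M. poly (Qpoly qp qm h) t = 0"
          using dvd by (auto elim: dvdE)
        then have "(LINT t|M. poly (Qpoly qp qm h) t) = 0"
          using integral_eq_zero_AE by blast
        then show ?thesis using h by simp
      qed
    qed
  qed
qed

text \<open>On the left only \<open>card V\<close> matters; keeping the set \<open>V\<close> lets an
  induction that removes its least element match the words on \<open>V\<close> directly. Setting
  \<open>w 0 = 0\<close> replaces the convention that the polynomial of index -1 is 0: at
  \<open>h = 0\<close> it cancels the truncated index \<open>h - 1\<close>.\<close>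

lemma is_mu_integral_power_Qpoly:
  assumes mu: "is_mu qp qm M" and "finite V"
  defines "w \<equiv> (\<lambda>k. if k = 0 then 0 else lam qp qm k)"
  shows "(LINT t|M. t ^ card V * poly (Qpoly qp qm h) t) = ballot_sum w h V"
  using \<open>finite V\<close>
proof (induction V arbitrary: h rule: finite_linorder_min_induct)
  case empty
  then show ?case using is_mu_integral_Qpoly[OF mu] by (simp add: ballot_sum_empty)
next
  case (insert v V)
  have "v \<notin> V" using insert.hyps(2) by auto
  then have card: "card (insert v V) = Suc (card V)" using insert.hyps(1) by simp
  have int: "integrable M (\<lambda>t. t ^ k * poly p t)" for k p
    using is_mu_integrable_poly[OF mu, of "monom 1 k * p"] by (simp add: poly_monom)
  have rec: "t * poly (Qpoly qp qm h) t =
      poly (Qpoly qp qm (Suc h)) t + w h * poly (Qpoly qp qm (h - 1)) t" for t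
    by (cases h) (auto simp: w_def algebra_simps)
  have "t ^ card (insert v V) * poly (Qpoly qp qm h) t =
     t ^ card V * poly (Qpoly qp qm (Suc h)) t +
     w h * (t ^ card V * poly (Qpoly qp qm (h - 1)) t)" for t
  proof -
    have "t ^ card (insert v V) * poly (Qpoly qp qm h) t =
      t ^ card V * (t * poly (Qpoly qp qm h) t)" by (simp add: card)
    also have "\<dots> = t ^ card V *
        (poly (Qpoly qp qm (Suc h)) t + w h * poly (Qpoly qp qm (h - 1)) t)"
      by (simp only: rec)
    finally show ?thesis by (simp add: algebra_simps)
  qed
  then have "(LINT t|M. t ^ card (insert v V) * poly (Qpoly qp qm h) t) =
     (LINT t|M. t ^ card V * poly (Qpoly qp qm (Suc h)) t) +
     w h * (LINT t|M. t ^ card V * poly (Qpoly qp qm (h - 1)) t)"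
    using int by (simp del: Qpoly.simps)
  also have "\<dots> = ballot_sum w h (insert v V)"
    using insert.IH ballot_sum_insert_Min[of V v w h] insert.hyps by (simp add: w_def)
  finally show ?case .
qed

subsection \<open>Contracting the first peak of a matching\<close>

text \<open>The legs are prescribed and may be any sets of naturals, so that deleting a pair stays
  inside the notion without relabelling points.\<close>

definition matchings :: "nat set \<Rightarrow> nat set \<Rightarrow> nat set set set" where
  "matchings L R = {\<pi>. partition_on (L \<union> R) \<pi> \<and> (\<forall>B\<in>\<pi>. \<exists>a\<in>L. \<exists>b\<in>R. a < b \<and> B = {a, b})}"

abbreviation swap_points :: "'a \<Rightarrow> 'a \<Rightarrow> 'a set set \<Rightarrow> 'a set set" where
  "swap_points l p \<pi> \<equiv> (`) (Transposition.transpose l p) ` \<pi>"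

lemma matchings_partition: "\<pi> \<in> matchings L R \<Longrightarrow> partition_on (L \<union> R) \<pi>"
  by (simp add: matchings_def)

lemma matchings_block:
  assumes "\<pi> \<in> matchings L R" "B \<in> \<pi>"
  obtains a b where "a \<in> L" "b \<in> R" "a < b" "B = {a, b}"
  using assms unfolding matchings_def by blast

lemma matchings_card: "\<pi> \<in> matchings L R \<Longrightarrow> \<forall>B\<in>\<pi>. card B = 2"
  unfolding matchings_def by fastforce

lemma finite_matchings: "finite L \<Longrightarrow> finite R \<Longrightarrow> finite (matchings L R)"
  by (rule finite_subset[of _ "Pow (Pow (L \<union> R))"]) (auto simp: matchings_def partition_on_def)

lemma matchings_partner:
  assumes "\<pi> \<in> matchings L R" "L \<inter> R = {}" "r \<in> R"
  obtains l where "l \<in> L" "l < r" "{l, r} \<in> \<pi>"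
proof -
  have "r \<in> \<Union> \<pi>" using partition_onD1[OF matchings_partition[OF assms(1)]] assms(3) by blast
  then obtain B where B: "B \<in> \<pi>" "r \<in> B" by auto
  then obtain a b where "a \<in> L" "b \<in> R" "a < b" "B = {a, b}"
    using matchings_block[OF assms(1)] by metis
  then show ?thesis using that[of a] assms(2,3) B by auto
qed

lemma swap_points_swap_points: "swap_points l p (swap_points l p \<pi>) = \<pi>"
  by (simp add: image_image)

text \<open>Since both points precede every right leg, exchanging them cannot reverse the order
  within a pair.\<close>

lemma matchings_swap_points:
  assumes \<pi>: "\<pi> \<in> matchings L R" and l: "l \<in> L" "p \<in> L" and disj: "L \<inter> R = {}"
    and less: "\<And>s. s \<in> R \<Longrightarrow> l < s \<and> p < s"
  shows "swap_points l p \<pi> \<in> matchings L R"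
proof -
  let ?t = "Transposition.transpose l p"
  have "?t ` (L \<union> R) = L \<union> R"
    using l by (auto simp: Transposition.transpose_def image_iff split: if_splits)
  then have "partition_on (L \<union> R) (swap_points l p \<pi>)"
    using partition_on_inj_image[OF matchings_partition[OF \<pi>], of ?t] image_is_empty
      partition_onD3[OF matchings_partition[OF \<pi>]] by (simp add: image_iff)
  moreover have "\<exists>a\<in>L. \<exists>b\<in>R. a < b \<and> ?t ` B = {a, b}" if "B \<in> \<pi>" for B
  proof -
    obtain a b where ab: "a \<in> L" "b \<in> R" "a < b" "B = {a, b}"
      using matchings_block[OF \<pi> \<open>B \<in> \<pi>\<close>] by metis
    then have "?t b = b" using l disj by (metis disjoint_iff transpose_apply_other)
    moreover have "?t a \<in> L" "?t a < b"
      using ab l less[OF ab(2)] by (auto simp: Transposition.transpose_def)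
    ultimately show ?thesis using ab by (intro bexI[of _ "?t a"] bexI[of _ b]) auto
  qed
  ultimately show ?thesis by (auto simp: matchings_def)
qed

lemma matchings_insert:
  assumes \<pi>: "\<pi> \<in> matchings (L - {p}) (R - {r})" and "p \<in> L" "r \<in> R" "p < r" "L \<inter> R = {}"
  shows "insert {p, r} \<pi> \<in> matchings L R" "{p, r} \<notin> \<pi>"
proof -
  have eq: "L - {p} \<union> (R - {r}) = L \<union> R - {p, r}" using assms by auto
  have P: "partition_on (L \<union> R - {p, r}) \<pi>" using matchings_partition[OF \<pi>] eq by simp
  have "partition_on (L \<union> R) (insert {p, r} \<pi>)"
  proof (rule partition_onI)
    show "\<Union> (insert {p, r} \<pi>) = L \<union> R" using partition_onD1[OF P] assms by auto
    show "disjnt B D" if "B \<in> insert {p, r} \<pi>" "D \<in> insert {p, r} \<pi>" "B \<noteq> D" for B D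
      using that partition_onD1[OF P] partition_onD2[OF P] by (auto simp: disjnt_def disjoint_def)
  qed (use partition_onD3[OF P] in auto)
  moreover have "\<exists>a\<in>L. \<exists>b\<in>R. a < b \<and> B = {a, b}" if "B \<in> insert {p, r} \<pi>" for B
    using that assms(2-4) matchings_block[OF \<pi>, of B] by (metis DiffD1 insertE)
  ultimately show "insert {p, r} \<pi> \<in> matchings L R" by (simp add: matchings_def)
  show "{p, r} \<notin> \<pi>" using partition_onD1[OF P] by auto
qed

lemma matchings_remove:
  assumes \<pi>: "\<pi> \<in> matchings L R" and B: "{p, r} \<in> \<pi>" and "p \<in> L" "r \<in> R" "L \<inter> R = {}"
  shows "\<pi> - {{p, r}} \<in> matchings (L - {p}) (R - {r})"
proof -
  have P: "partition_on (L \<union> R) \<pi>" using matchings_partition[OF \<pi>] .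
  have ni: "u \<notin> D" if "D \<in> \<pi> - {{p, r}}" "u \<in> {p, r}" for D u
    using partition_on_unique[OF P B, of D u] that by auto
  have eq: "L - {p} \<union> (R - {r}) = L \<union> R - {p, r}" using assms by auto
  have "partition_on (L - {p} \<union> (R - {r})) (\<pi> - {{p, r}})"
    unfolding eq
  proof (rule partition_onI)
    show "\<Union> (\<pi> - {{p, r}}) = L \<union> R - {p, r}" using partition_onD1[OF P] ni by blast
  qed (use partition_onD3[OF P] partition_onD2[OF P] in \<open>auto simp: disjnt_def disjoint_def\<close>)
  moreover have "\<exists>a\<in>L - {p}. \<exists>b\<in>R - {r}. a < b \<and> D = {a, b}" if D: "D \<in> \<pi> - {{p, r}}" for D
  proof -
    obtain a b where "a \<in> L" "b \<in> R" "a < b" "D = {a, b}" using matchings_block[OF \<pi>, of D] D by auto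
    moreover then have "a \<noteq> p" "b \<noteq> r" using ni[OF D, of p] ni[OF D, of r] by auto
    ultimately show ?thesis by blast
  qed
  ultimately show ?thesis by (simp add: matchings_def)
qed

section \<open>Non-crossing matchings and the first peak\<close>

lemma noncrossingI:
  assumes "\<And>B C a b c d. B \<in> \<pi> \<Longrightarrow> C \<in> \<pi> \<Longrightarrow> B \<noteq> C \<Longrightarrow> a \<in> B \<Longrightarrow> b \<in> C \<Longrightarrow> c \<in> B \<Longrightarrow> d \<in> C \<Longrightarrow>
    a < b \<Longrightarrow> b < c \<Longrightarrow> c < d \<Longrightarrow> False"
  shows "noncrossing \<pi>"
  unfolding noncrossing_def by (intro notI, elim bexE conjE) (rule assms)

lemma noncrossingD:
  "noncrossing \<pi> \<Longrightarrow> B \<in> \<pi> \<Longrightarrow> C \<in> \<pi> \<Longrightarrow> B \<noteq> C \<Longrightarrow> a \<in> B \<Longrightarrow> b \<in> C \<Longrightarrow> c \<in> B \<Longrightarrow> d \<in> C \<Longrightarrow>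
    a < b \<Longrightarrow> b < c \<Longrightarrow> c < d \<Longrightarrow> False"
  unfolding noncrossing_def by (drule notE) (intro bexI conjI; assumption)

lemma noncrossing_mono: "noncrossing \<sigma> \<Longrightarrow> \<tau> \<subseteq> \<sigma> \<Longrightarrow> noncrossing \<tau>"
  unfolding noncrossing_def by (meson subsetD)

text \<open>Read as a lattice path with up-steps at \<open>L\<close> and down-steps at
  \<open>R\<close>, the first peak consists of the steps \<open>p\<close> and \<open>r\<close>. They
  are neighbours in \<open>L \<union> R\<close>.\<close>

locale first_peak =
  fixes L R :: "nat set" and r p :: nat
  assumes finL: "finite L" and finR: "finite R" and disj: "L \<inter> R = {}"
    and rR: "r \<in> R" and r_le: "\<And>s. s \<in> R \<Longrightarrow> r \<le> s"
    and pL: "p \<in> L" and pr: "p < r" and p_ge: "\<And>l. l \<in> L \<Longrightarrow> l < r \<Longrightarrow> l \<le> p"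
begin

lemma swap_in_matchings:
  "\<pi> \<in> matchings L R \<Longrightarrow> l \<in> L \<Longrightarrow> l < r \<Longrightarrow> swap_points l p \<pi> \<in> matchings L R"
  by (rule matchings_swap_points) (use pL disj pr r_le in \<open>auto intro: less_le_trans\<close>)

lemma transpose_image_block:
  assumes "l \<in> L" "l < r"
  shows "Transposition.transpose l p ` {p, r} = {l, r}" "Transposition.transpose l p ` {l, r} = {p, r}"
  using assms pr by auto

text \<open>Exchanging \<open>p\<close> with the partner \<open>l\<close> of \<open>r\<close> turns a matching into one that contains \<open>{p, r}\<close>.\<close>

lemma sum_matchings:
  fixes g :: "nat set set \<Rightarrow> real"
  shows "(\<Sum>\<pi>\<in>matchings L R. g \<pi>) = (\<Sum>l | l \<in> L \<and> l < r.
           \<Sum>\<pi>\<in>matchings (L - {p}) (R - {r}). g (swap_points l p (insert {p, r} \<pi>)))"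
proof -
  let ?A = "{l. l \<in> L \<and> l < r}"
  define M where "M l = {\<pi> \<in> matchings L R. {l, r} \<in> \<pi>}" for l
  have "\<pi> \<in> (\<Union>l\<in>?A. M l)" if "\<pi> \<in> matchings L R" for \<pi>
    using matchings_partner[OF that disj rR] that unfolding M_def by blast
  then have UN: "matchings L R = (\<Union>l\<in>?A. M l)" unfolding M_def by blast
  have dis: "M l \<inter> M l' = {}" if "l \<noteq> l'" for l l'
  proof -
    have False if "\<pi> \<in> matchings L R" "{l, r} \<in> \<pi>" "{l', r} \<in> \<pi>" for \<pi>
      using partition_on_unique[OF matchings_partition[OF that(1)] that(2,3), of r] \<open>l \<noteq> l'\<close>
      by (simp add: doubleton_eq_iff)
    then show ?thesis unfolding M_def by blast
  qed
  have fM: "finite (M l)" for l using finite_matchings[OF finL finR] by (simp add: M_def)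
  have "(\<Sum>\<pi>\<in>matchings L R. g \<pi>) = (\<Sum>l\<in>?A. \<Sum>\<pi>\<in>M l. g \<pi>)"
    unfolding UN by (rule sum.UNION_disjoint) (use finL fM dis in auto)
  also have "\<dots> = (\<Sum>l\<in>?A. \<Sum>\<pi>\<in>matchings (L - {p}) (R - {r}). g (swap_points l p (insert {p, r} \<pi>)))"
  proof (rule sum.cong[OF refl])
    fix l assume "l \<in> ?A"
    then have l: "l \<in> L" "l < r" by auto
    show "(\<Sum>\<pi>\<in>M l. g \<pi>) =
      (\<Sum>\<pi>\<in>matchings (L - {p}) (R - {r}). g (swap_points l p (insert {p, r} \<pi>)))"
    proof (rule sum.reindex_bij_witness[where
          i = "\<lambda>\<pi>. swap_points l p (insert {p, r} \<pi>)" and j = "\<lambda>\<pi>. swap_points l p \<pi> - {{p, r}}"])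
      fix \<pi> assume "\<pi> \<in> M l"
      then have \<pi>: "\<pi> \<in> matchings L R" "{l, r} \<in> \<pi>" by (auto simp: M_def)
      have B: "{p, r} \<in> swap_points l p \<pi>"
        using \<pi>(2) transpose_image_block(2)[OF l] by (metis imageI)
      show "swap_points l p \<pi> - {{p, r}} \<in> matchings (L - {p}) (R - {r})"
        using matchings_remove[OF swap_in_matchings[OF \<pi>(1) l] B pL rR disj] .
      show "swap_points l p (insert {p, r} (swap_points l p \<pi> - {{p, r}})) = \<pi>"
        using B by (simp only: insert_Diff swap_points_swap_points)
      then show "g (swap_points l p (insert {p, r} (swap_points l p \<pi> - {{p, r}}))) = g \<pi>" by simp
    next
      fix \<pi> assume \<pi>: "\<pi> \<in> matchings (L - {p}) (R - {r})"
      note ins = matchings_insert[OF \<pi> pL rR pr disj]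
      show "swap_points l p (swap_points l p (insert {p, r} \<pi>)) - {{p, r}} = \<pi>"
        using ins(2) by (simp only: swap_points_swap_points) simp
      show "swap_points l p (insert {p, r} \<pi>) \<in> M l"
        unfolding M_def using swap_in_matchings[OF ins(1) l] transpose_image_block(1)[OF l]
        by (metis (mono_tags, lifting) imageI insertI1 mem_Collect_eq)
    qed
  qed
  finally show ?thesis .
qed

lemma between: "u \<in> L \<union> R \<Longrightarrow> p < u \<Longrightarrow> u < r \<Longrightarrow> False"
  using p_ge r_le by fastforce

text \<open>If \<open>r\<close> had a partner \<open>a\<close> other than \<open>p\<close>, then
  \<open>a < p\<close>, and \<open>p\<close> would have a partner \<open>b\<close> beyond the first
  right leg \<open>r\<close>; the points \<open>a < p < r < b\<close> would be a crossing.\<close>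

lemma noncrossing_peak:
  assumes \<sigma>: "\<sigma> \<in> matchings L R" and nc: "noncrossing \<sigma>"
  shows "{p, r} \<in> \<sigma>"
proof -
  have P: "partition_on (L \<union> R) \<sigma>" using matchings_partition[OF \<sigma>] .
  obtain a where a: "a \<in> L" "a < r" "{a, r} \<in> \<sigma>" using matchings_partner[OF \<sigma> disj rR] .
  have "p \<in> \<Union> \<sigma>" using partition_onD1[OF P] pL by blast
  then obtain B where B: "B \<in> \<sigma>" "p \<in> B" by auto
  then obtain a' b where ab: "a' \<in> L" "b \<in> R" "a' < b" "B = {a', b}"
    using matchings_block[OF \<sigma>] by metis
  then have B': "B = {p, b}" "p < b" using B(2) pL disj by auto
  have "a = p"
  proof (rule ccontr)
    assume "a \<noteq> p"
    then have "a < p" using p_ge[OF a(1,2)] by simp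
    show False
    proof (cases "b = r")
      case True
      then show False
        using partition_on_unique[OF P a(3) B(1), of r] B' \<open>a \<noteq> p\<close> by (auto simp: doubleton_eq_iff)
    next
      case False
      then have "r < b" using r_le[OF ab(2)] by simp
      then have "{a, r} \<noteq> B" using B' \<open>a < p\<close> pr by auto
      then show False
        using noncrossingD[OF nc a(3) B(1), of a p r b] \<open>a < p\<close> \<open>r < b\<close> pr B'(1) by simp
    qed
  qed
  then show ?thesis using a by simp
qed

text \<open>A pair crossing \<open>{p, r}\<close> would need a point strictly between two
  neighbours.\<close>

lemma noncrossing_insert_peak:
  assumes \<sigma>: "\<sigma> \<in> matchings (L - {p}) (R - {r})" and nc: "noncrossing \<sigma>"
  shows "noncrossing (insert {p, r} \<sigma>)"
proof -
  have sub: "u \<in> L \<union> R" if "B \<in> insert {p, r} \<sigma>" "u \<in> B" for B u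
    using that partition_onD1[OF matchings_partition[OF \<sigma>]] pL rR by auto
  show ?thesis
  proof (rule noncrossingI)
    fix B C a b c d
    assume B: "B \<in> insert {p, r} \<sigma>" and C: "C \<in> insert {p, r} \<sigma>" and "B \<noteq> C"
      and abcd: "a \<in> B" "b \<in> C" "c \<in> B" "d \<in> C" "a < b" "b < c" "c < d"
    have "B \<noteq> {p, r}"
    proof
      assume "B = {p, r}"
      then have "a = p" "c = r" using abcd(1,3,5,6) pr by auto
      then show False using between[OF sub[OF C abcd(2)]] abcd(5,6) by simp
    qed
    moreover have "C \<noteq> {p, r}"
    proof
      assume "C = {p, r}"
      then have "b = p" "d = r" using abcd(2,4,6,7) pr by auto
      then show False using between[OF sub[OF B abcd(3)]] abcd(6,7) by simp
    qed
    ultimately have "B \<in> \<sigma>" "C \<in> \<sigma>" using B C by auto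
    then show False using noncrossingD[OF nc _ _ \<open>B \<noteq> C\<close> abcd] by simp
  qed
qed

text \<open>For \<open>l = p\<close> the pair \<open>{p, r}\<close> lies in both matchings and is a
  component of its own. Otherwise, if \<open>b\<close> is the partner of \<open>l\<close> in
  \<open>\<pi>\<close>, the edge \<open>{l, b}\<close> is replaced by the path from \<open>l\<close>
  to \<open>r\<close>, on to \<open>p\<close>, and on to \<open>b\<close>; contracting it changes no
  component.\<close>

lemma card_components_peak:
  assumes \<pi>: "\<pi> \<in> matchings (L - {p}) (R - {r})" and \<sigma>: "\<sigma> \<in> matchings (L - {p}) (R - {r})"
    and l: "l \<in> L" "l < r"
  shows "card (components (L \<union> R) (swap_points l p (insert {p, r} \<pi>) \<union> insert {p, r} \<sigma>)) =
         card (components (L - {p} \<union> (R - {r})) (\<pi> \<union> \<sigma>)) + (if l = p then 1 else 0)"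
proof -
  let ?t = "Transposition.transpose l p"
  have V': "L - {p} \<union> (R - {r}) = L \<union> R - {p, r}" using pL rR disj pr by auto
  have U: "\<Union> \<pi> = L \<union> R - {p, r}" "\<Union> \<sigma> = L \<union> R - {p, r}"
    using matchings_partition[OF \<pi>] matchings_partition[OF \<sigma>] V' partition_onD1 by metis+
  show ?thesis
  proof (cases "l = p")
    case True
    have "components ({p, r} \<union> (L \<union> R - {p, r})) (insert {p, r} (\<pi> \<union> \<sigma>)) =
        insert {p, r} (components (L \<union> R - {p, r}) (\<pi> \<union> \<sigma>))"
      using U by (intro components_insert_block) auto
    moreover have "{p, r} \<union> (L \<union> R - {p, r}) = L \<union> R" using pL rR by auto
    moreover have "swap_points p p (insert {p, r} \<pi>) \<union> insert {p, r} \<sigma> = insert {p, r} (\<pi> \<union> \<sigma>)"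
      by simp
    moreover have "{p, r} \<notin> components (L \<union> R - {p, r}) (\<pi> \<union> \<sigma>)"
      using components_subset[of "{p, r}"] by blast
    moreover have "finite (components (L \<union> R - {p, r}) (\<pi> \<union> \<sigma>))"
      using finL finR by (intro finite_components) auto
    ultimately show ?thesis using True V' by simp
  next
    case False
    define E where "E = swap_points l p (insert {p, r} \<pi>) \<union> insert {p, r} \<sigma>"
    \<comment> \<open>Contracts the new path to its end \<open>l\<close>. On points other than
      \<open>p\<close> and \<open>r\<close> it undoes the transposition.\<close>
    define \<rho> where "\<rho> u = (if u = p \<or> u = r then l else u)" for u
    have lr: "l \<noteq> r" using l by simp
    have "{l, r} \<in> E"
      using transpose_image_block(1)[OF l] unfolding E_def by (metis UnI1 imageI insertI1)
    then have lr_conn: "(r, l) \<in> (adjacency E)\<^sup>*" by (intro adjacent_connected[of "{l, r}"]) auto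
    have "{p, r} \<in> E" by (simp add: E_def)
    then have "(p, r) \<in> (adjacency E)\<^sup>*" by (intro adjacent_connected[of "{p, r}"]) auto
    then have pl_conn: "(p, l) \<in> (adjacency E)\<^sup>*" using lr_conn by (rule rtrancl_trans)
    have t_conn: "(u, ?t u) \<in> (adjacency E)\<^sup>*" for u
      using pl_conn connected_sym[OF pl_conn]
      by (cases "u = l"; cases "u = p") (simp_all add: Transposition.transpose_def)
    have \<rho>t: "\<rho> (?t u) = u" if "u \<noteq> p" "u \<noteq> r" for u
      using that by (auto simp: \<rho>_def Transposition.transpose_def)
    have \<rho>id: "\<rho> u = u" if "u \<noteq> p" "u \<noteq> r" for u using that by (simp add: \<rho>_def)
    have "card (components (L \<union> R) E) = card (components (L \<union> R - {p, r}) (\<pi> \<union> \<sigma>))"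
    proof (rule card_components_retract[where \<rho> = \<rho>])
      show "\<rho> u \<in> L \<union> R - {p, r}" if "u \<in> L \<union> R" for u
        using that l False by (auto simp: \<rho>_def)
      show "(u, \<rho> u) \<in> (adjacency E)\<^sup>*" for u
        using lr_conn pl_conn by (simp add: \<rho>_def)
      show "(\<rho> u, \<rho> v) \<in> (adjacency (\<pi> \<union> \<sigma>))\<^sup>*" if B: "B \<in> E" "u \<in> B" "v \<in> B" for B u v
      proof -
        consider "B = {l, r}" | "B = {p, r}" | D where "D \<in> \<pi>" "B = ?t ` D" | "B \<in> \<sigma>"
          using B(1) transpose_image_block(1)[OF l] unfolding E_def by blast
        then show ?thesis
        proof cases
          case 3
          then obtain u' v' where u': "u = ?t u'" "v = ?t v'" "u' \<in> D" "v' \<in> D" using B(2,3) by blast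
          then have "\<rho> u = u'" "\<rho> v = v'" using \<rho>t U(1) 3(1) by auto
          then show ?thesis using u' 3 by (auto intro: adjacent_connected[of D])
        next
          case 4
          then have "\<rho> u = u" "\<rho> v = v" using \<rho>id U(2) B by auto
          then show ?thesis using 4 B by (auto intro: adjacent_connected[of B])
        qed (use B lr in \<open>auto simp: \<rho>_def\<close>)
      qed
      show "(u, v) \<in> (adjacency E)\<^sup>*" if B: "B \<in> \<pi> \<union> \<sigma>" "u \<in> B" "v \<in> B" for B u v
        using B(1)
      proof
        assume "B \<in> \<sigma>"
        then show ?thesis using that by (intro adjacent_connected[of B]) (auto simp: E_def)
      next
        assume "B \<in> \<pi>"
        then have "(?t u, ?t v) \<in> (adjacency E)\<^sup>*"
          using that by (intro adjacent_connected[of "?t ` B"]) (auto simp: E_def)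
        then show ?thesis using t_conn[of u] connected_sym[OF t_conn[of v]] by (meson rtrancl_trans)
      qed
    qed (auto simp: \<rho>id)
    then show ?thesis using False V' by (simp add: E_def)
  qed
qed

text \<open>Every later right leg has both \<open>p\<close> and \<open>r\<close> before it, so
  deleting them leaves its number of open arcs unchanged. At \<open>r\<close> itself no arc has been
  closed yet.\<close>

lemma ballot_weight_peak:
  "ballot_weight w 0 L R = w (card {l \<in> L. l < r}) * ballot_weight w 0 (L - {p}) (R - {r})"
proof -
  have "ballot_weight w 0 L R =
      w (card {l \<in> L. l < r} - card {s \<in> R. s < r}) *
      (\<Prod>s\<in>R - {r}. w (card {l \<in> L. l < s} - card {u \<in> R. u < s}))"
    unfolding ballot_weight_def using prod.remove[OF finR rR] by simp
  moreover have "{s \<in> R. s < r} = {}" using r_le by fastforce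
  moreover have "card {l \<in> L. l < s} - card {u \<in> R. u < s} =
      card {l \<in> L - {p}. l < s} - card {u \<in> R - {r}. u < s}" if "s \<in> R - {r}" for s
  proof -
    have s: "r < s" using that r_le[of s] by auto
    have "{l \<in> L. l < s} = insert p {l \<in> L - {p}. l < s}" "{u \<in> R. u < s} = insert r {u \<in> R - {r}. u < s}"
      using s pr pL rR by auto
    then have "card {l \<in> L. l < s} = Suc (card {l \<in> L - {p}. l < s})"
      "card {u \<in> R. u < s} = Suc (card {u \<in> R - {r}. u < s})"
      using finL finR by simp_all
    then show ?thesis by simp
  qed
  ultimately show ?thesis unfolding ballot_weight_def by simp
qed

lemma peak_smaller: "finite (L - {p})" "finite (R - {r})" "(L - {p}) \<inter> (R - {r}) = {}"
  "card R = Suc (card (R - {r}))" "card L = Suc (card (L - {p}))"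
  using card.remove[OF finR rR] card.remove[OF finL pL] finL finR disj by auto

lemma matchings_nonempty_iff: "matchings L R = {} \<longleftrightarrow> matchings (L - {p}) (R - {r}) = {}"
proof
  assume "matchings L R = {}"
  then show "matchings (L - {p}) (R - {r}) = {}" using matchings_insert(1)[OF _ pL rR pr disj] by blast
next
  assume *: "matchings (L - {p}) (R - {r}) = {}"
  show "matchings L R = {}"
  proof (rule ccontr)
    assume "matchings L R \<noteq> {}"
    then obtain \<pi> where \<pi>: "\<pi> \<in> matchings L R" by auto
    then obtain l where l: "l \<in> L" "l < r" "{l, r} \<in> \<pi>" using matchings_partner[OF _ disj rR] by metis
    then have "{p, r} \<in> swap_points l p \<pi>" using transpose_image_block(2)[OF l(1,2)] by (metis imageI)
    then show False
      using matchings_remove[OF swap_in_matchings[OF \<pi> l(1,2)] _ pL rR disj] * by auto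
  qed
qed

end

text \<open>In the second alternative the first right leg has no left leg before it: there is no
  matching, and the ballot weight contains the factor \<open>w 0\<close>.\<close>

lemma first_peak_exists:
  assumes "finite L" "finite R" "L \<inter> R = {}" "R \<noteq> {}"
  obtains r p where "first_peak L R r p"
    | r where "r \<in> R" "\<And>s. s \<in> R \<Longrightarrow> r \<le> s" "\<And>l. l \<in> L \<Longrightarrow> \<not> l < r"
proof (cases "{l \<in> L. l < Min R} = {}")
  case True
  then show ?thesis using that(2)[of "Min R"] assms by auto
next
  case False
  have "Max {l \<in> L. l < Min R} \<in> {l \<in> L. l < Min R}" using False assms(1) by (intro Max_in) auto
  then have "first_peak L R (Min R) (Max {l \<in> L. l < Min R})"
    using assms by unfold_locales auto
  then show ?thesis by (rule that(1))
qed

lemma matchings_empty: "matchings {} {} = {{}}"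
  by (auto simp: matchings_def partition_on_def)

lemma matchings_card_eq:
  assumes "\<pi> \<in> matchings L R" "finite L" "finite R" "L \<inter> R = {}"
  shows "card \<pi> = card L" "card L = card R"
proof -
  have P: "partition_on (L \<union> R) \<pi>" using matchings_partition[OF assms(1)] .
  have legs: "B \<inter> L \<noteq> {} \<and> card (B \<inter> L) = 1 \<and> B \<inter> R \<noteq> {} \<and> card (B \<inter> R) = 1" if "B \<in> \<pi>" for B
  proof -
    obtain a b where ab: "a \<in> L" "b \<in> R" "B = {a, b}"
      using matchings_block[OF assms(1) \<open>B \<in> \<pi>\<close>] by metis
    then have "B \<inter> L = {a}" "B \<inter> R = {b}" using assms(4) by auto
    then show ?thesis by simp
  qed
  have "card X = card \<pi>" if X: "X \<subseteq> L \<union> R" "\<And>B. B \<in> \<pi> \<Longrightarrow> card (B \<inter> X) = 1" for X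
  proof -
    have "finite \<pi>" using assms(2,3) P by (auto intro: finite_elements)
    moreover have fin: "finite X" using X(1) assms(2,3) finite_subset by blast
    moreover have "X = (\<Union>B\<in>\<pi>. B \<inter> X)" using X(1) partition_onD1[OF P] by blast
    moreover have "\<forall>B\<in>\<pi>. \<forall>D\<in>\<pi>. B \<noteq> D \<longrightarrow> (B \<inter> X) \<inter> (D \<inter> X) = {}"
      using partition_onD2[OF P] by (auto simp: disjoint_def)
    ultimately have "card X = (\<Sum>B\<in>\<pi>. card (B \<inter> X))"
      using card_UN_disjoint[of \<pi> "\<lambda>B. B \<inter> X"] by auto
    then show ?thesis using X(2) by simp
  qed
  from this[of L] this[of R] legs show "card \<pi> = card L" "card L = card R" by auto
qed

text \<open>The peak is forced to be a pair, and what remains is a non-crossing matching of the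
  smaller sets.\<close>

lemma noncrossing_matching_ex1:
  assumes "finite L" "finite R" "L \<inter> R = {}" "matchings L R \<noteq> {}"
  shows "\<exists>!\<sigma>. \<sigma> \<in> matchings L R \<and> noncrossing \<sigma>"
  using assms
proof (induction "card R" arbitrary: L R)
  case 0
  then obtain \<pi> where \<pi>: "\<pi> \<in> matchings L R" by blast
  have "R = {}" using 0 by simp
  moreover have "L = {}" using matchings_card_eq(2)[OF \<pi> 0(2-4)] 0 by simp
  ultimately show ?case by (auto simp: matchings_empty noncrossing_def)
next
  case (Suc n)
  have "R \<noteq> {}" using Suc.hyps(2) by auto
  from Suc.prems(1-3) this show ?case
  proof (cases rule: first_peak_exists)
    case (1 r p)
    interpret first_peak L R r p by (rule 1)
    have "n = card (R - {r})" using Suc.hyps(2) peak_smaller(4) by linarith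
    moreover have "matchings (L - {p}) (R - {r}) \<noteq> {}"
      using Suc.prems(4) matchings_nonempty_iff by blast
    ultimately have ex1: "\<exists>!\<sigma>. \<sigma> \<in> matchings (L - {p}) (R - {r}) \<and> noncrossing \<sigma>"
      by (rule Suc.hyps(1)[OF _ peak_smaller(1-3)])
    then obtain \<sigma> where \<sigma>: "\<sigma> \<in> matchings (L - {p}) (R - {r}) \<and> noncrossing \<sigma>" by (rule ex1E)
    show ?thesis
    proof (rule ex1I[of _ "insert {p, r} \<sigma>"])
      show "insert {p, r} \<sigma> \<in> matchings L R \<and> noncrossing (insert {p, r} \<sigma>)"
        using \<sigma> by (intro conjI noncrossing_insert_peak matchings_insert(1)[OF _ pL rR pr disj]) auto
      fix \<tau> assume \<tau>: "\<tau> \<in> matchings L R \<and> noncrossing \<tau>"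
      then have B: "{p, r} \<in> \<tau>" by (intro noncrossing_peak) auto
      have "\<tau> - {{p, r}} \<in> matchings (L - {p}) (R - {r}) \<and> noncrossing (\<tau> - {{p, r}})"
        using \<tau> B matchings_remove[OF _ B pL rR disj] noncrossing_mono[of \<tau> "\<tau> - {{p, r}}"] by simp
      then have "\<tau> - {{p, r}} = \<sigma>" using ex1 \<sigma> by (elim ex1E) (metis (no_types, lifting))
      then show "\<tau> = insert {p, r} \<sigma>" using B by (metis insert_Diff)
    qed
  next
    case (2 r)
    obtain \<pi> where "\<pi> \<in> matchings L R" using Suc.prems(4) by blast
    then obtain l where "l \<in> L" "l < r" using matchings_partner[OF _ Suc.prems(3) 2(1)] by metis
    then show ?thesis using 2(3) by blast
  qed
qed

text \<open>With \<open>k\<close> left legs before \<open>r\<close>, the partner \<open>p\<close>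
  contributes \<open>x\<close> and each of the other \<open>k - 1\<close> partners contributes
  \<open>y\<close>, independently of the rest of the matching; this is \<open>w k\<close>. If no
  matching exists, the sum is empty and \<open>\<sigma>\<close> is arbitrary, which allows an
  induction over all \<open>L\<close> and \<open>R\<close>, whether or not they form a ballot
  word.\<close>

lemma sum_matchings_eq_ballot_weight:
  fixes x y :: real
  assumes "finite L" "finite R" "L \<inter> R = {}" "card L = card R"
    and w: "w 0 = 0" "\<And>k. k \<ge> 1 \<Longrightarrow> w k = x + (real k - 1) * y"
    and \<sigma>: "\<sigma> \<in> matchings L R \<and> noncrossing \<sigma> \<or> matchings L R = {}"
  shows "(\<Sum>\<pi>\<in>matchings L R. x ^ card (components (L \<union> R) (\<pi> \<union> \<sigma>)) *
            y ^ (card L - card (components (L \<union> R) (\<pi> \<union> \<sigma>)))) = ballot_weight w 0 L R"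
  using assms(1-4) \<sigma>
proof (induction "card R" arbitrary: L R \<sigma>)
  case 0
  then have "L = {}" "R = {}" by auto
  moreover have "components {} E = {}" for E :: "nat set set" by (simp add: components_eq)
  ultimately show ?case using 0 by (simp add: matchings_empty ballot_weight_def)
next
  case (Suc n)
  have "R \<noteq> {}" using Suc.hyps(2) by auto
  from Suc.prems(1-3) this show ?case
  proof (cases rule: first_peak_exists)
    case (2 r)
    have "{l \<in> L. l < r} = {}" "{s \<in> R. s < r} = {}" using 2 by fastforce+
    then have "w (0 + card {l \<in> L. l < r} - card {s \<in> R. s < r}) = 0" using w(1) by (simp only: card.empty) simp
    then have "ballot_weight w 0 L R = 0"
      unfolding ballot_weight_def using 2(1) Suc.prems(2) by (intro prod_zero) auto
    moreover have "matchings L R = {}"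
    proof (rule equals0I)
      fix \<pi> assume "\<pi> \<in> matchings L R"
      then obtain l where "l \<in> L" "l < r" using matchings_partner[OF _ Suc.prems(3) 2(1)] by metis
      then show False using 2(3) by blast
    qed
    ultimately show ?thesis by simp
  next
    case (1 r p)
    interpret first_peak L R r p by (rule 1)
    let ?L = "L - {p}" and ?R = "R - {r}" and ?\<sigma> = "\<sigma> - {{p, r}}"
    let ?A = "{l \<in> L. l < r}"
    define c where "c \<pi> = card (components (?L \<union> ?R) (\<pi> \<union> ?\<sigma>))" for \<pi>
    have \<sigma>': "?\<sigma> \<in> matchings ?L ?R \<and> noncrossing ?\<sigma> \<and> insert {p, r} ?\<sigma> = \<sigma>" if "matchings L R \<noteq> {}"
      using that Suc.prems(5) noncrossing_peak[of \<sigma>] matchings_remove[of \<sigma> L R p r] pL rR disj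
        noncrossing_mono[of \<sigma> ?\<sigma>] by auto
    have cards: "n = card ?R" "card ?L = card ?R"
      using Suc.hyps(2) Suc.prems(4) peak_smaller(4,5) by linarith+
    have IH: "(\<Sum>\<pi>\<in>matchings ?L ?R. x ^ c \<pi> * y ^ (card ?L - c \<pi>)) = ballot_weight w 0 ?L ?R"
      unfolding c_def using \<sigma>' matchings_nonempty_iff
      by (intro Suc.hyps(1) peak_smaller(1-3) cards) blast
    have "(\<Sum>\<pi>\<in>matchings L R. x ^ card (components (L \<union> R) (\<pi> \<union> \<sigma>)) *
            y ^ (card L - card (components (L \<union> R) (\<pi> \<union> \<sigma>)))) =
       (\<Sum>l\<in>?A. \<Sum>\<pi>\<in>matchings ?L ?R. (if l = p then x else y) * (x ^ c \<pi> * y ^ (card ?L - c \<pi>)))"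
      unfolding sum_matchings
    proof (intro sum.cong refl)
      fix l \<pi> assume l: "l \<in> ?A" and \<pi>: "\<pi> \<in> matchings ?L ?R"
      then have ne: "matchings L R \<noteq> {}" using matchings_nonempty_iff by auto
      have sg: "?\<sigma> \<in> matchings ?L ?R" "insert {p, r} ?\<sigma> = \<sigma>" using \<sigma>'[OF ne] by auto
      have c: "card (components (L \<union> R) (swap_points l p (insert {p, r} \<pi>) \<union> \<sigma>)) =
          c \<pi> + (if l = p then 1 else 0)"
        using card_components_peak[OF \<pi> sg(1), of l, unfolded sg(2)] l unfolding c_def by blast
      \<comment> \<open>Needed for the exponent of \<open>y\<close>: a truncated difference grows by
        one with \<open>card L\<close> only if it was not cut off.\<close>
      have "c \<pi> \<le> card \<pi>"
        unfolding c_def using matchings_partition[OF \<pi>] matchings_partition[OF sg(1)] peak_smaller(1,2)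
        by (intro card_components_le) (auto simp: partition_on_def)
      then have "c \<pi> \<le> card ?L" using matchings_card_eq(1)[OF \<pi> peak_smaller(1-3)] by simp
      then show "x ^ card (components (L \<union> R) (swap_points l p (insert {p, r} \<pi>) \<union> \<sigma>)) *
          y ^ (card L - card (components (L \<union> R) (swap_points l p (insert {p, r} \<pi>) \<union> \<sigma>))) =
          (if l = p then x else y) * (x ^ c \<pi> * y ^ (card ?L - c \<pi>))"
        unfolding c peak_smaller(5) by (simp add: Suc_diff_le del: card_Diff_singleton)
    qed
    also have "\<dots> = (\<Sum>l\<in>?A. if l = p then x else y) * ballot_weight w 0 ?L ?R"
      using IH by (simp add: sum_distrib_left[symmetric] sum_distrib_right)
    also have "(\<Sum>l\<in>?A. if l = p then x else y) = w (card ?A)"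
    proof -
      have pA: "p \<in> ?A" "finite ?A" using pL pr finL by auto
      then have "(\<Sum>l\<in>?A. if l = p then x else y) = x + (\<Sum>l\<in>?A - {p}. y)"
        by (subst sum.remove[of _ p]) auto
      moreover have "card ?A \<ge> 1" using pA by (metis One_nat_def Suc_leI card_gt_0_iff empty_iff)
      ultimately show ?thesis using w(2) pA by (simp add: card_Diff_singleton of_nat_diff)
    qed
    finally show ?thesis using ballot_weight_peak by simp
  qed
qed

section \<open>Matchings of an interval, grouped by their left legs\<close>

lemma legs_matchings:
  assumes \<pi>: "\<pi> \<in> matchings L R" and disj: "L \<inter> R = {}"
  shows "Min ` \<pi> = L" "Max ` \<pi> = R"
proof -
  have block: "Min B \<in> L \<and> Max B \<in> R \<and> B = {Min B, Max B}" if "B \<in> \<pi>" for B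
  proof -
    obtain a b where "a \<in> L" "b \<in> R" "a < b" "B = {a, b}"
      using matchings_block[OF \<pi> \<open>B \<in> \<pi>\<close>] by metis
    then show ?thesis by (auto simp: max_def)
  qed
  have ex: "\<exists>B\<in>\<pi>. u \<in> B" if "u \<in> L \<union> R" for u
    using that partition_onD1[OF matchings_partition[OF \<pi>]] by auto
  show "Min ` \<pi> = L"
  proof (intro equalityI subsetI)
    fix u assume u: "u \<in> L"
    then obtain B where B: "B \<in> \<pi>" "u \<in> B" using ex[of u] by auto
    then have "u = Min B" using block[OF B(1)] u disj by (metis disjoint_iff insertE singletonD)
    then show "u \<in> Min ` \<pi>" using B by simp
  qed (use block in auto)
  show "Max ` \<pi> = R"
  proof (intro equalityI subsetI)
    fix u assume u: "u \<in> R"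
    then obtain B where B: "B \<in> \<pi>" "u \<in> B" using ex[of u] by auto
    then have "u = Max B" using block[OF B(1)] u disj by (metis disjoint_iff insertE singletonD)
    then show "u \<in> Max ` \<pi>" using B by simp
  qed (use block in auto)
qed

lemma P2_partition: "\<pi> \<in> P2 N \<Longrightarrow> partition_on {1..N} \<pi>"
  and P2_card: "\<pi> \<in> P2 N \<Longrightarrow> \<forall>B\<in>\<pi>. card B = 2"
  and P2_Union: "\<pi> \<in> P2 N \<Longrightarrow> \<Union> \<pi> = {1..N}"
  by (auto simp: P2_def partition_on_def)

lemma finite_P2: "finite (P2 N)"
  by (rule finite_subset[of _ "Pow (Pow {1..N})"]) (auto simp: P2_def partition_on_def)

lemma finite_P2_elem: "\<pi> \<in> P2 N \<Longrightarrow> finite \<pi>"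
  by (rule finite_elements[OF _ P2_partition]) auto

lemma P2_block:
  assumes "\<pi> \<in> P2 N" "B \<in> \<pi>"
  obtains a b where "a < b" "B = {a, b}" "1 \<le> a" "b \<le> N" "Min B = a" "Max B = b"
proof -
  obtain a b where ab: "a \<noteq> b" "B = {a, b}" using P2_card[OF assms(1)] assms(2) by (auto simp: card_2_iff)
  moreover have "B \<subseteq> {1..N}" using P2_Union[OF assms(1)] assms(2) by auto
  ultimately show ?thesis
    using that[of a b] that[of b a] by (cases a b rule: linorder_cases) (auto simp: insert_commute max_def)
qed

lemma P2_in_matchings:
  assumes \<pi>: "\<pi> \<in> P2 N"
  shows "\<pi> \<in> matchings (Min ` \<pi>) ({1..N} - Min ` \<pi>)" "Min ` \<pi> \<subseteq> {1..N}"
proof -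
  show sub: "Min ` \<pi> \<subseteq> {1..N}"
  proof (rule image_subsetI)
    fix B assume "B \<in> \<pi>"
    then obtain a b where "a < b" "1 \<le> a" "b \<le> N" "Min B = a" using P2_block[OF \<pi>] by metis
    then show "Min B \<in> {1..N}" by simp
  qed
  have "\<exists>a\<in>Min ` \<pi>. \<exists>b\<in>{1..N} - Min ` \<pi>. a < b \<and> B = {a, b}" if "B \<in> \<pi>" for B
  proof -
    obtain a b where ab: "a < b" "B = {a, b}" "1 \<le> a" "b \<le> N" "Min B = a"
      using P2_block[OF \<pi> \<open>B \<in> \<pi>\<close>] by metis
    have "b \<noteq> Min D" if D: "D \<in> \<pi>" for D
    proof
      assume "b = Min D"
      then have "b \<in> D" using P2_block[OF \<pi> D] by (metis insertI1)
      then have "D = B" using partition_on_unique[OF P2_partition[OF \<pi>] D \<open>B \<in> \<pi>\<close>] ab by auto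
      then show False using \<open>b = Min D\<close> ab by simp
    qed
    then have "b \<in> {1..N} - Min ` \<pi>" using ab by auto
    moreover have "a \<in> Min ` \<pi>" using ab(5) \<open>B \<in> \<pi>\<close> by (metis imageI)
    ultimately show ?thesis using ab by blast
  qed
  moreover have "Min ` \<pi> \<union> ({1..N} - Min ` \<pi>) = {1..N}" using sub by auto
  ultimately show "\<pi> \<in> matchings (Min ` \<pi>) ({1..N} - Min ` \<pi>)"
    unfolding matchings_def using P2_partition[OF \<pi>] by simp
qed

lemma matchings_in_P2: "L \<subseteq> {1..N} \<Longrightarrow> \<pi> \<in> matchings L ({1..N} - L) \<Longrightarrow> \<pi> \<in> P2 N"
  using matchings_partition[of \<pi> L "{1..N} - L"] matchings_card[of \<pi> L "{1..N} - L"]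
  by (simp add: P2_def Un_absorb1)

text \<open>In a matching of \<open>{1..N}\<close> the right legs are the complement of the left
  legs, so prescribing the left legs prescribes both, and the result for fixed leg sets
  applies.\<close>

lemma hat_matching_unique:
  assumes \<pi>: "\<pi> \<in> P2 N"
  shows "\<exists>!\<sigma>. \<sigma> \<in> P2 N \<and> noncrossing \<sigma> \<and> Min ` \<sigma> = Min ` \<pi>"
proof -
  let ?L = "Min ` \<pi>" let ?R = "{1..N} - ?L"
  have L: "?L \<subseteq> {1..N}" "finite ?L" using P2_in_matchings(2)[OF \<pi>] finite_subset by auto
  have "\<exists>!\<sigma>. \<sigma> \<in> matchings ?L ?R \<and> noncrossing \<sigma>"
    using P2_in_matchings(1)[OF \<pi>] L by (intro noncrossing_matching_ex1) auto
  moreover have "\<sigma> \<in> matchings ?L ?R \<longleftrightarrow> \<sigma> \<in> P2 N \<and> Min ` \<sigma> = ?L" for \<sigma>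
    using matchings_in_P2[OF L(1), of \<sigma>] legs_matchings(1)[of \<sigma> ?L ?R] P2_in_matchings(1)[of \<sigma> N]
    by auto
  ultimately show ?thesis by (simp add: conj_ac)
qed

lemma hat_matching:
  assumes "\<pi> \<in> P2 N"
  shows "hat_matching N \<pi> \<in> P2 N" "noncrossing (hat_matching N \<pi>)"
    "Min ` hat_matching N \<pi> = Min ` \<pi>"
  using theI'[OF hat_matching_unique[OF assms]] unfolding hat_matching_def by auto

lemma hat_matching_eqI:
  assumes "\<pi> \<in> P2 N" "\<sigma> \<in> P2 N" "noncrossing \<sigma>" "Min ` \<sigma> = Min ` \<pi>"
  shows "\<sigma> = hat_matching N \<pi>"
  using hat_matching_unique[OF assms(1)] hat_matching[OF assms(1)] assms(2-4) by blast

lemma right_legs_P2: "\<pi> \<in> P2 N \<Longrightarrow> Max ` \<pi> = {1..N} - Min ` \<pi>"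
  using legs_matchings(2)[OF P2_in_matchings(1)] by blast

lemma left_legs_P2: "\<pi> \<in> P2 N \<Longrightarrow> Min ` \<pi> = {1..N} - Max ` \<pi>"
  using right_legs_P2 P2_in_matchings(2) by (simp add: double_diff)

text \<open>Both sides are sums over sets \<open>L\<close> of left legs. Sets that are not ballot
  words have no matching and contribute 0 to either side.\<close>

lemma sum_P2_eq_ballot_sum:
  fixes x y :: real
  assumes w: "w 0 = 0" "\<And>k. k \<ge> 1 \<Longrightarrow> w k = x + (real k - 1) * y"
  shows "(\<Sum>\<pi>\<in>P2 (2 * n). x ^ num_cycles (2 * n) \<pi> * y ^ (n - num_cycles (2 * n) \<pi>)) =
    ballot_sum w 0 {1..2 * n}"
proof -
  let ?V = "{1..2 * n}"
  define f where "f \<pi> = x ^ num_cycles (2 * n) \<pi> * y ^ (n - num_cycles (2 * n) \<pi>)" for \<pi>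
  define \<L> where "\<L> = {L. L \<subseteq> ?V \<and> card L + 0 = card (?V - L)}"
  have fin\<L>: "finite \<L>" by (simp add: \<L>_def)
  have L: "L \<subseteq> ?V" "finite L" "card L = n" "card L = card (?V - L)" if "L \<in> \<L>" for L
  proof -
    show L: "L \<subseteq> ?V" "card L = card (?V - L)" using that by (auto simp: \<L>_def)
    then show "finite L" using finite_subset by blast
    then show "card L = n" using L by (simp add: card_Diff_subset)
  qed
  have "P2 (2 * n) = (\<Union>L\<in>\<L>. matchings L (?V - L))"
  proof (intro equalityI subsetI)
    fix \<pi> assume \<pi>: "\<pi> \<in> P2 (2 * n)"
    have "finite (Min ` \<pi>)" using P2_in_matchings(2)[OF \<pi>] finite_subset by blast
    then have "card (Min ` \<pi>) = card (?V - Min ` \<pi>)"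
      using matchings_card_eq(2)[OF P2_in_matchings(1)[OF \<pi>]] by auto
    then have "Min ` \<pi> \<in> \<L>" using P2_in_matchings(2)[OF \<pi>] by (simp add: \<L>_def)
    then show "\<pi> \<in> (\<Union>L\<in>\<L>. matchings L (?V - L))" using P2_in_matchings(1)[OF \<pi>] by blast
  next
    fix \<pi> assume "\<pi> \<in> (\<Union>L\<in>\<L>. matchings L (?V - L))"
    then show "\<pi> \<in> P2 (2 * n)" using matchings_in_P2 L(1) by blast
  qed
  then have "(\<Sum>\<pi>\<in>P2 (2 * n). f \<pi>) = (\<Sum>\<pi>\<in>(\<Union>L\<in>\<L>. matchings L (?V - L)). f \<pi>)" by simp
  also have "\<dots> = (\<Sum>L\<in>\<L>. \<Sum>\<pi>\<in>matchings L (?V - L). f \<pi>)"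
  proof (rule sum.UNION_disjoint[OF fin\<L>])
    show "\<forall>L\<in>\<L>. finite (matchings L (?V - L))" using L(2) finite_matchings by blast
    have "Min ` \<pi> = L" if "\<pi> \<in> matchings L (?V - L)" for \<pi> L
      using legs_matchings(1)[OF that] by blast
    then show "\<forall>L\<in>\<L>. \<forall>L'\<in>\<L>. L \<noteq> L' \<longrightarrow> matchings L (?V - L) \<inter> matchings L' (?V - L') = {}"
      by blast
  qed
  also have "\<dots> = (\<Sum>L\<in>\<L>. ballot_weight w 0 L (?V - L))"
  proof (rule sum.cong[OF refl])
    fix L assume "L \<in> \<L>"
    note L = L[OF this]
    have V: "L \<union> (?V - L) = ?V" using L(1) by auto
    have ex: "\<exists>\<sigma>. \<sigma> \<in> matchings L (?V - L) \<and> noncrossing \<sigma> \<or> matchings L (?V - L) = {}"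
      using noncrossing_matching_ex1[of L "?V - L"] L(2) by blast
    then obtain \<sigma> where \<sigma>: "\<sigma> \<in> matchings L (?V - L) \<and> noncrossing \<sigma> \<or> matchings L (?V - L) = {}" ..
    have "f \<pi> = x ^ card (components (L \<union> (?V - L)) (\<pi> \<union> \<sigma>)) *
            y ^ (card L - card (components (L \<union> (?V - L)) (\<pi> \<union> \<sigma>)))"
      if \<pi>: "\<pi> \<in> matchings L (?V - L)" for \<pi>
    proof -
      have \<sigma>': "\<sigma> \<in> matchings L (?V - L)" "noncrossing \<sigma>" using \<sigma> \<pi> by auto
      have "\<sigma> = hat_matching (2 * n) \<pi>"
        using legs_matchings(1)[OF \<pi>] legs_matchings(1)[OF \<sigma>'(1)] \<sigma>'
        by (intro hat_matching_eqI matchings_in_P2[OF L(1)] \<pi>) auto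
      then show ?thesis unfolding f_def num_cycles_def V L(3) by simp
    qed
    then have "(\<Sum>\<pi>\<in>matchings L (?V - L). f \<pi>) =
      (\<Sum>\<pi>\<in>matchings L (?V - L). x ^ card (components (L \<union> (?V - L)) (\<pi> \<union> \<sigma>)) *
            y ^ (card L - card (components (L \<union> (?V - L)) (\<pi> \<union> \<sigma>))))"
      by (rule sum.cong[OF refl])
    also have "\<dots> = ballot_weight w 0 L (?V - L)"
      using L w \<sigma> by (intro sum_matchings_eq_ballot_weight) auto
    finally show "(\<Sum>\<pi>\<in>matchings L (?V - L). f \<pi>) = ballot_weight w 0 L (?V - L)" .
  qed
  also have "\<dots> = ballot_sum w 0 ?V" by (simp add: ballot_sum_def \<L>_def)
  finally show ?thesis by (simp add: f_def)
qed

subsection \<open>Signs on the pairs of a matching\<close>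

text \<open>\<open>T\<close> is the set of negative pairs of \<open>\<pi>\<close>; all pairs of \<open>\<sigma>\<close> are positive. As for signed graphs,
  balance means that the signs come from a labelling of the points, \<open>A\<close> being one label class.\<close>

definition balanced :: "'a set set \<Rightarrow> 'a set set \<Rightarrow> 'a set set \<Rightarrow> 'a set \<Rightarrow> bool" where
  "balanced \<pi> \<sigma> T C \<longleftrightarrow> (\<exists>A\<subseteq>C. (\<forall>B\<in>\<sigma>. B \<subseteq> C \<longrightarrow> B \<subseteq> A \<or> B \<inter> A = {}) \<and>
     (\<forall>B\<in>\<pi>. B \<subseteq> C \<longrightarrow> (B \<in> T \<longleftrightarrow> \<not> (B \<subseteq> A \<or> B \<inter> A = {}))))"

section \<open>Sums over sign choices, factored over components\<close>

lemma sum_Pow_Un: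
  assumes "A \<inter> B = {}"
  shows "(\<Sum>T\<in>Pow (A \<union> B). g (T \<inter> A) * h (T \<inter> B)) = (\<Sum>T\<in>Pow A. g T) * (\<Sum>T\<in>Pow B. h T :: real)"
proof -
  have "(\<Sum>T\<in>Pow A. g T) * (\<Sum>T\<in>Pow B. h T) = (\<Sum>(S, T)\<in>Pow A \<times> Pow B. g S * h T)"
    by (simp add: sum_product sum.cartesian_product)
  also have "\<dots> = (\<Sum>T\<in>Pow (A \<union> B). g (T \<inter> A) * h (T \<inter> B))"
    by (rule sum.reindex_bij_witness[where i = "\<lambda>T. (T \<inter> A, T \<inter> B)" and j = "\<lambda>(S, T). S \<union> T"])
      (use assms in \<open>auto intro!: arg_cong2[where f = "(*)"] arg_cong[where f = g] arg_cong[where f = h]\<close>)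
  finally show ?thesis ..
qed

text \<open>A subset of a disjoint union is an independent choice of a subset of each part; here the
  parts are the pairs on the different cycles.\<close>

lemma sum_Pow_UN_prod:
  fixes g :: "'b \<Rightarrow> 'a set \<Rightarrow> real"
  assumes "finite \<C>" and "\<And>C D. C \<in> \<C> \<Longrightarrow> D \<in> \<C> \<Longrightarrow> C \<noteq> D \<Longrightarrow> P C \<inter> P D = {}"
  shows "(\<Sum>T\<in>Pow (\<Union>C\<in>\<C>. P C). \<Prod>C\<in>\<C>. g C (T \<inter> P C)) = (\<Prod>C\<in>\<C>. \<Sum>T\<in>Pow (P C). g C T)"
  using assms
proof (induction \<C> rule: finite_induct)
  case empty
  then show ?case by simp
next
  case (insert C \<C>)
  let ?U = "\<Union>C\<in>\<C>. P C"
  have disj: "P C \<inter> ?U = {}" using insert.prems insert.hyps(2) by blast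
  have "(\<Sum>T\<in>Pow (\<Union>C\<in>insert C \<C>. P C). \<Prod>D\<in>insert C \<C>. g D (T \<inter> P D)) =
     (\<Sum>T\<in>Pow (P C \<union> ?U). g C (T \<inter> P C) * (\<Prod>D\<in>\<C>. g D ((T \<inter> ?U) \<inter> P D)))"
  proof (rule sum.cong)
    fix T
    have "T \<inter> ?U \<inter> P D = T \<inter> P D" if "D \<in> \<C>" for D using that by auto
    then show "(\<Prod>D\<in>insert C \<C>. g D (T \<inter> P D)) = g C (T \<inter> P C) * (\<Prod>D\<in>\<C>. g D ((T \<inter> ?U) \<inter> P D))"
      using insert.hyps by simp
  qed simp
  also have "\<dots> = (\<Sum>T\<in>Pow (P C). g C T) * (\<Sum>T\<in>Pow ?U. \<Prod>D\<in>\<C>. g D (T \<inter> P D))"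
    by (rule sum_Pow_Un[OF disj])
  also have "\<dots> = (\<Sum>T\<in>Pow (P C). g C T) * (\<Prod>C\<in>\<C>. \<Sum>T\<in>Pow (P C). g C T)"
    using insert.IH insert.prems by simp
  finally show ?case using insert.hyps by simp
qed

text \<open>A labelling of the component is a choice of label for each pair of \<open>\<sigma>\<close>, and two labellings
  induce the same signs only if they agree up to a global change of sign, which is ruled out by
  fixing the label of one point \<open>c0\<close>.\<close>

lemma card_balanced:
  assumes \<pi>: "partition_on V \<pi>" "\<forall>B\<in>\<pi>. card B = 2" and \<sigma>: "partition_on V \<sigma>" "\<forall>B\<in>\<sigma>. card B = 2"
    and fin: "finite V" and C: "C \<in> components V (\<pi> \<union> \<sigma>)"
  defines "m \<equiv> card {B \<in> \<pi>. B \<subseteq> C}"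
  shows "card {T. T \<subseteq> {B \<in> \<pi>. B \<subseteq> C} \<and> balanced \<pi> \<sigma> T C} = 2 ^ (m - 1)" "1 \<le> m"
proof -
  let ?P = "{B \<in> \<pi>. B \<subseteq> C}" and ?S = "{B \<in> \<sigma>. B \<subseteq> C}"
  have U: "\<Union> (\<pi> \<union> \<sigma>) \<subseteq> V" using partition_onD1[OF \<pi>(1)] partition_onD1[OF \<sigma>(1)] by auto
  note cases = component_cases[OF U C]
  have CV: "C \<subseteq> V" using components_subset[OF C] .
  have PS: "partition_on C ?P" "partition_on C ?S"
    using cases by (auto intro!: partition_on_restrict[OF \<pi>(1) CV] partition_on_restrict[OF \<sigma>(1) CV])
  have finC: "finite C" using CV fin finite_subset by blast
  have cardC: "card C = 2 * m" "card C = 2 * card ?S"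
    using card_component_matching[OF \<pi> _ U C] card_component_matching[OF \<sigma> _ U C] by (auto simp: m_def)
  have "C \<noteq> {}" using components_nonempty[OF C] .
  then obtain c0 where c0: "c0 \<in> C" by auto
  then obtain B0 where B0: "B0 \<in> ?S" "c0 \<in> B0" using partition_onD1[OF PS(2)] by blast
  show m: "1 \<le> m" using cardC(1) \<open>C \<noteq> {}\<close> finC by (cases m) auto
  define sep where "sep A = {B \<in> ?P. \<not> (B \<subseteq> A \<or> B \<inter> A = {})}" for A
  \<comment> \<open>Labels constant on the pairs of \<open>\<sigma>\<close> are unions of such
    pairs. Leaving out \<open>B0\<close>, the pair of \<open>c0\<close>, keeps exactly one of a
    labelling and its complement.\<close>
  define \<A> where "\<A> = Union ` Pow (?S - {B0})"
  have \<A>: "A \<subseteq> C" "c0 \<notin> A" "\<And>B. B \<in> ?S \<Longrightarrow> B \<subseteq> A \<or> B \<inter> A = {}" if A: "A \<in> \<A>" for A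
  proof -
    obtain K where K: "K \<subseteq> ?S - {B0}" "A = \<Union> K" using A by (auto simp: \<A>_def)
    show "A \<subseteq> C" using K by auto
    show "c0 \<notin> A" using partition_on_unique[OF PS(2) B0(1) _ B0(2)] K by blast
    show "B \<subseteq> A \<or> B \<inter> A = {}" if B: "B \<in> ?S" for B
      using partition_on_unique[OF PS(2) B] K by blast
  qed
  have in\<A>: "A \<in> \<A>" if A: "A \<subseteq> C" "c0 \<notin> A" "\<And>B. B \<in> ?S \<Longrightarrow> B \<subseteq> A \<or> B \<inter> A = {}" for A
  proof -
    have "A \<subseteq> \<Union> {B \<in> ?S. B \<subseteq> A}"
    proof
      fix u assume u: "u \<in> A"
      then obtain B where "B \<in> ?S" "u \<in> B" using A(1) partition_onD1[OF PS(2)] by blast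
      then show "u \<in> \<Union> {B \<in> ?S. B \<subseteq> A}" using A(3)[of B] u by blast
    qed
    then have "A = \<Union> {B \<in> ?S. B \<subseteq> A}" by blast
    moreover have "{B \<in> ?S. B \<subseteq> A} \<in> Pow (?S - {B0})" using A(2) B0(2) by blast
    ultimately show ?thesis unfolding \<A>_def by (rule image_eqI)
  qed
  have "inj_on Union (Pow (?S - {B0}))"
  proof (rule inj_onI)
    fix K K' assume K: "K \<in> Pow (?S - {B0})" "K' \<in> Pow (?S - {B0})" "\<Union> K = \<Union> K'"
    have sub: "X \<subseteq> Y" if XY: "X \<in> Pow (?S - {B0})" "Y \<in> Pow (?S - {B0})" "\<Union> X = \<Union> Y" for X Y
    proof
      fix B assume B: "B \<in> X"
      then have BS: "B \<in> ?S" using XY by blast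
      then have "B \<noteq> {}" using partition_onD3[OF PS(2)] by blast
      then obtain u where u: "u \<in> B" by blast
      then obtain B' where "B' \<in> Y" "u \<in> B'" using XY(3) B by blast
      then show "B \<in> Y" using partition_on_unique[OF PS(2) BS, of B' u] u XY(2) by blast
    qed
    show "K = K'" using sub[OF K] sub[OF K(2,1) K(3)[symmetric]] by (rule equalityI)
  qed
  then have "card \<A> = 2 ^ (card ?S - 1)"
    unfolding \<A>_def using B0(1) finite_elements[OF finC PS(2)]
    by (simp add: card_image card_Pow)
  then have card\<A>: "card \<A> = 2 ^ (m - 1)" using cardC by simp
  have sep_inj: "inj_on sep \<A>"
  proof (rule inj_onI)
    fix A A' assume A: "A \<in> \<A>" and A': "A' \<in> \<A>" and eq: "sep A = sep A'"
    \<comment> \<open>If two labellings cut the same pairs, no edge leaves the set \<open>D\<close>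
      on which they differ. The component \<open>C\<close> is connected and \<open>c0\<close> is not
      in \<open>D\<close>, so \<open>D\<close> is empty.\<close>
    define D where "D = (A - A') \<union> (A' - A)"
    have D: "B \<subseteq> D \<or> B \<inter> D = {}" if "B \<in> \<pi> \<union> \<sigma>" for B
    proof (cases "B \<subseteq> C")
      case False
      then show ?thesis using cases[OF that] \<A>(1)[OF A] \<A>(1)[OF A'] by (auto simp: D_def)
    next
      case True
      show ?thesis
      proof (cases "B \<in> \<sigma>")
        case True
        then show ?thesis using \<A>(3)[OF A, of B] \<A>(3)[OF A', of B] \<open>B \<subseteq> C\<close> by (auto simp: D_def)
      next
        case False
        then have B: "B \<in> ?P" using that True by auto
        then obtain u v where uv: "B = {u, v}" using \<pi>(2) by (auto simp: card_2_iff)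
        have "B \<in> sep A \<longleftrightarrow> B \<in> sep A'" using eq by simp
        then have "(u \<in> A \<longleftrightarrow> v \<in> A) \<longleftrightarrow> (u \<in> A' \<longleftrightarrow> v \<in> A')"
          using B unfolding sep_def uv by auto
        then show ?thesis unfolding uv D_def by auto
      qed
    qed
    have "D = {}"
    proof (rule ccontr)
      assume "D \<noteq> {}"
      then obtain u where u: "u \<in> D" by auto
      then have "u \<in> C" using \<A>(1)[OF A] \<A>(1)[OF A'] by (auto simp: D_def)
      then have "c0 \<in> component V (\<pi> \<union> \<sigma>) u" using components_eqI[OF C] c0 by metis
      then have "(u, c0) \<in> (adjacency (\<pi> \<union> \<sigma>))\<^sup>*" by (simp add: component_def)
      then have "c0 \<in> D" using connected_closed[of "\<pi> \<union> \<sigma>" D, OF D] u by blast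
      then show False using \<A>(2)[OF A] \<A>(2)[OF A'] by (auto simp: D_def)
    qed
    then show "A = A'" by (auto simp: D_def)
  qed
  have "{T. T \<subseteq> ?P \<and> balanced \<pi> \<sigma> T C} = sep ` \<A>"
  proof (intro equalityI subsetI)
    fix T assume "T \<in> {T. T \<subseteq> ?P \<and> balanced \<pi> \<sigma> T C}"
    then obtain A where T: "T \<subseteq> ?P" and AC: "A \<subseteq> C"
      and A\<sigma>: "\<And>B. B \<in> ?S \<Longrightarrow> B \<subseteq> A \<or> B \<inter> A = {}"
      and A\<pi>: "\<And>B. B \<in> ?P \<Longrightarrow> B \<in> T \<longleftrightarrow> \<not> (B \<subseteq> A \<or> B \<inter> A = {})"
      unfolding balanced_def by auto
    have TA: "T = sep A" using T A\<pi> unfolding sep_def by blast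
    show "T \<in> sep ` \<A>"
    proof (cases "c0 \<in> A")
      case False
      then show ?thesis using in\<A>[OF AC _ A\<sigma>] TA by blast
    next
      case True
      \<comment> \<open>Complementary labellings cut the same pairs, so the one that avoids
        \<open>c0\<close> can be used.\<close>
      have "C - A \<in> \<A>" using A\<sigma> True by (intro in\<A>) auto
      moreover have "sep (C - A) = sep A" unfolding sep_def by blast
      ultimately show ?thesis using TA by blast
    qed
  next
    fix T assume "T \<in> sep ` \<A>"
    then obtain A where A: "A \<in> \<A>" "T = sep A" by auto
    have "balanced \<pi> \<sigma> T C"
      unfolding balanced_def
    proof (intro exI conjI ballI impI)
      show "A \<subseteq> C" using \<A>(1)[OF A(1)] .
      show "B \<subseteq> A \<or> B \<inter> A = {}" if "B \<in> \<sigma>" "B \<subseteq> C" for B using \<A>(3)[OF A(1)] that by blast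
      show "B \<in> T \<longleftrightarrow> \<not> (B \<subseteq> A \<or> B \<inter> A = {})" if "B \<in> \<pi>" "B \<subseteq> C" for B
        using that unfolding A(2) sep_def by blast
    qed
    then show "T \<in> {T. T \<subseteq> ?P \<and> balanced \<pi> \<sigma> T C}" using A(2) by (auto simp: sep_def)
  qed
  then show "card {T. T \<subseteq> ?P \<and> balanced \<pi> \<sigma> T C} = 2 ^ (m - 1)"
    using card_image[OF sep_inj] card\<A> by simp
qed

lemma sum_component_pairs:
  assumes \<pi>: "partition_on V \<pi>" and fin: "finite V" and E: "\<pi> \<subseteq> E" "\<Union> E \<subseteq> V"
  shows "(\<Sum>C\<in>components V E. card {B \<in> \<pi>. B \<subseteq> C}) = card \<pi>"
    and "(\<Union>C\<in>components V E. {B \<in> \<pi>. B \<subseteq> C}) = \<pi>"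
    and "C \<in> components V E \<Longrightarrow> D \<in> components V E \<Longrightarrow> C \<noteq> D \<Longrightarrow>
      {B \<in> \<pi>. B \<subseteq> C} \<inter> {B \<in> \<pi>. B \<subseteq> D} = {}"
proof -
  have "B \<in> (\<Union>C\<in>components V E. {B \<in> \<pi>. B \<subseteq> C})" if B: "B \<in> \<pi>" for B
  proof -
    have "B \<noteq> {}" "B \<subseteq> V" using B partition_onD1[OF \<pi>] partition_onD3[OF \<pi>] by auto
    then obtain u where "u \<in> B" "u \<in> V" by blast
    then have "u \<in> \<Union> (components V E)" by (simp add: Union_components)
    then obtain C where C: "C \<in> components V E" "u \<in> C" by (rule UnionE)
    have "B \<in> E" using B E(1) by blast
    then have "B \<subseteq> C" using component_cases[OF E(2) C(1)] C(2) \<open>u \<in> B\<close> by blast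
    then show ?thesis using C(1) B by blast
  qed
  then show U: "(\<Union>C\<in>components V E. {B \<in> \<pi>. B \<subseteq> C}) = \<pi>" by blast
  show dis: "{B \<in> \<pi>. B \<subseteq> C} \<inter> {B \<in> \<pi>. B \<subseteq> D} = {}"
    if "C \<in> components V E" "D \<in> components V E" "C \<noteq> D" for C D
  proof -
    have "C \<inter> D = {}" using disjointD[OF disjoint_components] that by blast
    then have "B = {}" if "B \<subseteq> C" "B \<subseteq> D" for B using that by blast
    then show ?thesis using partition_onD3[OF \<pi>] by auto
  qed
  have "finite \<pi>" using finite_elements[OF fin \<pi>] .
  then have "card (\<Union>C\<in>components V E. {B \<in> \<pi>. B \<subseteq> C}) =
      (\<Sum>C\<in>components V E. card {B \<in> \<pi>. B \<subseteq> C})"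
    using finite_components[OF fin] dis by (intro card_UN_disjoint) auto
  then show "(\<Sum>C\<in>components V E. card {B \<in> \<pi>. B \<subseteq> C}) = card \<pi>" using U by simp
qed

text \<open>A component with \<open>m\<close> pairs of \<open>\<pi>\<close> has \<open>2 ^ m\<close>
  sign choices, half of them balanced, and so contributes \<open>2 ^ (m - 1) * (1 + q)\<close>. The
  product over the components collects the exponents \<open>m - 1\<close> into
  \<open>card \<pi> - card \<C>\<close>.\<close>

lemma sum_unbalanced:
  fixes q :: real
  assumes \<pi>: "partition_on V \<pi>" "\<forall>B\<in>\<pi>. card B = 2" and \<sigma>: "partition_on V \<sigma>" "\<forall>B\<in>\<sigma>. card B = 2"
    and fin: "finite V"
  defines "\<C> \<equiv> components V (\<pi> \<union> \<sigma>)"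
  shows "(\<Sum>T\<in>Pow \<pi>. q ^ card {C \<in> \<C>. \<not> balanced \<pi> \<sigma> T C}) =
     2 ^ (card \<pi> - card \<C>) * (1 + q) ^ card \<C>"
    and "(\<Sum>C\<in>\<C>. card C div 2 - 1) = card \<pi> - card \<C>"
proof -
  define P where "P C = {B \<in> \<pi>. B \<subseteq> C}" for C
  define g where "g C T = (if balanced \<pi> \<sigma> T C then 1 else q)" for C T
  have U: "\<Union> (\<pi> \<union> \<sigma>) \<subseteq> V" using partition_onD1[OF \<pi>(1)] partition_onD1[OF \<sigma>(1)] by auto
  have fin\<C>: "finite \<C>" unfolding \<C>_def using finite_components[OF fin] .
  note comp = sum_component_pairs[OF \<pi>(1) fin Un_upper1 U, folded \<C>_def P_def]
  have fin\<pi>: "finite \<pi>" using finite_elements[OF fin \<pi>(1)] .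
  have finP: "finite (P C)" for C using fin\<pi> by (simp add: P_def)
  note cb = card_balanced[OF \<pi> \<sigma> fin, folded \<C>_def P_def]
  have total: "(\<Sum>C\<in>\<C>. card (P C) - 1) = card \<pi> - card \<C>"
    using cb(2) comp(1) by (simp add: sum_subtractf_nat)
  have "card C div 2 = card (P C)" if "C \<in> \<C>" for C
    using card_component_matching[OF \<pi> Un_upper1 U] that unfolding \<C>_def P_def by simp
  then show "(\<Sum>C\<in>\<C>. card C div 2 - 1) = card \<pi> - card \<C>" using total by simp
  \<comment> \<open>Balance on \<open>C\<close> sees only the signs of the pairs inside
    \<open>C\<close>; this is what lets the sum factor.\<close>
  have gT: "g C T = g C (T \<inter> P C)" for C T
    unfolding g_def balanced_def P_def by (intro if_cong refl arg_cong[where f = Ex] ext) blast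
  have sumg: "(\<Sum>T\<in>Pow (P C). g C T) = 2 ^ (card (P C) - 1) * (1 + q)" if C: "C \<in> \<C>" for C
  proof -
    define Y where "Y = {T. T \<subseteq> P C \<and> balanced \<pi> \<sigma> T C}"
    have Y: "Y \<subseteq> Pow (P C)" "card Y = 2 ^ (card (P C) - 1)" using cb(1)[OF C] by (auto simp: Y_def)
    have "card (Pow (P C)) = 2 * 2 ^ (card (P C) - 1)"
      using cb(2)[OF C] finP[of C] by (cases "card (P C)") (auto simp: card_Pow)
    moreover have "finite Y" using Y finP finite_subset by blast
    ultimately have Y': "card (Pow (P C) - Y) = 2 ^ (card (P C) - 1)"
      using Y by (simp add: card_Diff_subset)
    have "(\<Sum>T\<in>Pow (P C). g C T) = (\<Sum>T\<in>Y. g C T) + (\<Sum>T\<in>Pow (P C) - Y. g C T)"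
      using sum.subset_diff[OF Y(1)] finP by (simp add: add.commute)
    also have "(\<Sum>T\<in>Y. g C T) = (\<Sum>T\<in>Y. 1)" by (rule sum.cong) (auto simp: Y_def g_def)
    also have "(\<Sum>T\<in>Pow (P C) - Y. g C T) = (\<Sum>T\<in>Pow (P C) - Y. q)"
      by (rule sum.cong) (auto simp: Y_def g_def)
    finally show ?thesis using Y Y' by (simp add: algebra_simps)
  qed
  have "(\<Sum>T\<in>Pow \<pi>. q ^ card {C \<in> \<C>. \<not> balanced \<pi> \<sigma> T C}) = (\<Sum>T\<in>Pow \<pi>. \<Prod>C\<in>\<C>. g C (T \<inter> P C))"
  proof (rule sum.cong[OF refl])
    fix T
    have "(\<Prod>C\<in>\<C>. g C T) = (\<Prod>C\<in>{C \<in> \<C>. \<not> balanced \<pi> \<sigma> T C}. q)"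
      using fin\<C> by (intro prod.mono_neutral_cong_right) (auto simp: g_def)
    then show "q ^ card {C \<in> \<C>. \<not> balanced \<pi> \<sigma> T C} = (\<Prod>C\<in>\<C>. g C (T \<inter> P C))"
      unfolding gT[symmetric] by simp
  qed
  also have "\<dots> = (\<Prod>C\<in>\<C>. \<Sum>T\<in>Pow (P C). g C T)"
    using sum_Pow_UN_prod[OF fin\<C>, of P g] comp(2,3) by simp
  also have "\<dots> = (\<Prod>C\<in>\<C>. 2 ^ (card (P C) - 1) * (1 + q))"
    by (rule prod.cong[OF refl sumg])
  also have "\<dots> = 2 ^ (card \<pi> - card \<C>) * (1 + q) ^ card \<C>"
    by (simp only: prod.distrib power_sum[symmetric] total prod_constant)
  finally show "(\<Sum>T\<in>Pow \<pi>. q ^ card {C \<in> \<C>. \<not> balanced \<pi> \<sigma> T C}) =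
     2 ^ (card \<pi> - card \<C>) * (1 + q) ^ card \<C>" .
qed

subsection \<open>Symmetric matchings as double covers\<close>

abbreviation nabs :: "int \<Rightarrow> nat" where "nabs u \<equiv> nat \<bar>u\<bar>"

text \<open>\<open>T\<close> is the set of pairs of \<open>\<pi>\<close> that are lifted to pairs of numbers of opposite sign.\<close>

definition lift :: "nat set set \<Rightarrow> nat set set \<Rightarrow> int set set" where
  "lift \<pi> T = {{u, v} | u v. {nabs u, nabs v} \<in> \<pi> \<and> (u * v < 0 \<longleftrightarrow> {nabs u, nabs v} \<in> T)}"

lemma lift_iff:
  "{u, v} \<in> lift \<pi> T \<longleftrightarrow> {nabs u, nabs v} \<in> \<pi> \<and> (u * v < 0 \<longleftrightarrow> {nabs u, nabs v} \<in> T)"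
proof
  assume "{u, v} \<in> lift \<pi> T"
  then obtain u' v' where "{u, v} = {u', v'}"
    "{nabs u', nabs v'} \<in> \<pi> \<and> (u' * v' < 0 \<longleftrightarrow> {nabs u', nabs v'} \<in> T)"
    unfolding lift_def by blast
  then show "{nabs u, nabs v} \<in> \<pi> \<and> (u * v < 0 \<longleftrightarrow> {nabs u, nabs v} \<in> T)"
    by (auto simp: doubleton_eq_iff insert_commute mult.commute)
qed (auto simp: lift_def)

lemma liftE:
  assumes "B \<in> lift \<pi> T"
  obtains u v where "B = {u, v}" "{nabs u, nabs v} \<in> \<pi>" "u * v < 0 \<longleftrightarrow> {nabs u, nabs v} \<in> T"
  using assms unfolding lift_def by blast

lemma lift_blockE:
  assumes "B \<in> lift \<pi> T" "u \<in> B"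
  obtains v where "B = {u, v}" "{nabs u, nabs v} \<in> \<pi>" "u * v < 0 \<longleftrightarrow> {nabs u, nabs v} \<in> T"
proof -
  obtain a b where "B = {a, b}" using liftE[OF assms(1)] by metis
  then have "B = {u, if u = a then b else a}" using assms(2) by auto
  then obtain v where v: "B = {u, v}" by blast
  then show ?thesis using assms(1) that[OF v] unfolding v lift_iff by blast
qed

lemma pm_iff: "u \<in> pm N \<longleftrightarrow> nabs u \<in> {1..N}"
  by (auto simp: pm_def)

lemma finite_pm: "finite (pm N)"
  by (simp add: pm_def)

lemma card_pm: "card (pm N) = 2 * N"
  by (simp add: pm_def)

lemma nabs_eq_iff: "nabs u = nabs v \<longleftrightarrow> u = v \<or> u = - v"
  by auto

lemma nabs_int: "nabs (int a) = a" "nabs (- int a) = a"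
  by simp_all

lemma P2_block_facts:
  assumes \<pi>: "\<pi> \<in> P2 N" and B: "{nabs u, nabs v} \<in> \<pi>"
  shows "nabs u \<noteq> nabs v" "u \<in> pm N" "v \<in> pm N" "u \<noteq> 0" "v \<noteq> 0" "u \<noteq> v" "u \<noteq> - v"
proof -
  have "card {nabs u, nabs v} = 2" using P2_card[OF \<pi>] B by blast
  then show 1: "nabs u \<noteq> nabs v" by auto
  show 2: "u \<in> pm N" "v \<in> pm N" using P2_Union[OF \<pi>] B by (auto simp only: pm_iff)
  show "u \<noteq> 0" "v \<noteq> 0" using 2 by (auto simp: pm_def)
  show "u \<noteq> v" "u \<noteq> - v" using 1 by auto
qed

lemma lift_card: "\<pi> \<in> P2 N \<Longrightarrow> \<forall>B\<in>lift \<pi> T. card B = 2"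
  using P2_block_facts(6) by (metis card_2_iff liftE)

lemma partner_P2:
  assumes \<pi>: "\<pi> \<in> P2 N" and a: "a \<in> {1..N}"
  obtains b where "{a, b} \<in> \<pi>"
proof -
  obtain B where B: "B \<in> \<pi>" "a \<in> B" using P2_Union[OF \<pi>] a by (metis UnionE)
  then obtain c d where "B = {c, d}" using P2_card[OF \<pi>] by (metis card_2_iff)
  then show ?thesis using that B by (metis insertE insert_commute singletonD)
qed

lemma lift_in_P2sym:
  assumes \<pi>: "\<pi> \<in> P2 N"
  shows "lift \<pi> T \<in> P2sym N"
proof -
  have U: "\<Union> (lift \<pi> T) = pm N"
  proof (intro equalityI subsetI)
    fix u assume "u \<in> \<Union> (lift \<pi> T)"
    then obtain B where "B \<in> lift \<pi> T" "u \<in> B" by auto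
    then show "u \<in> pm N" using P2_block_facts(2,3)[OF \<pi>] by (metis insertE liftE singletonD)
  next
    fix u assume u: "u \<in> pm N"
    then obtain b where b: "{nabs u, b} \<in> \<pi>" using partner_P2[OF \<pi>] by (auto simp only: pm_iff)
    have nz: "u \<noteq> 0" "int b \<noteq> 0" using P2_block_facts(4,5)[OF \<pi>, of u "int b"] b by (auto simp: nabs_int)
    \<comment> \<open>The partner of \<open>u\<close> lies over \<open>b\<close>; its sign is the
      one for which the product with \<open>u\<close> is negative exactly if the pair belongs to
      \<open>T\<close>.\<close>
    define v where "v = (if (u * int b < 0) = ({nabs u, b} \<in> T) then int b else - int b)"
    have "u * v < 0 \<longleftrightarrow> {nabs u, b} \<in> T" "nabs v = b"
      using nz by (auto simp: v_def mult_less_0_iff zero_less_mult_iff)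
    then have "{u, v} \<in> lift \<pi> T" using b by (simp add: lift_iff)
    then show "u \<in> \<Union> (lift \<pi> T)" by blast
  qed
  have dis: "B = D" if BD: "B \<in> lift \<pi> T" "D \<in> lift \<pi> T" "u \<in> B" "u \<in> D" for B D u
  proof -
    obtain v where v: "B = {u, v}" "{nabs u, nabs v} \<in> \<pi>" "u * v < 0 \<longleftrightarrow> {nabs u, nabs v} \<in> T"
      using lift_blockE[OF BD(1,3)] .
    obtain w where w: "D = {u, w}" "{nabs u, nabs w} \<in> \<pi>" "u * w < 0 \<longleftrightarrow> {nabs u, nabs w} \<in> T"
      using lift_blockE[OF BD(2,4)] .
    have "{nabs u, nabs v} = {nabs u, nabs w}"
      by (rule partition_on_unique[OF P2_partition[OF \<pi>] v(2) w(2), of "nabs u"]) auto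
    then have "nabs v = nabs w" by (auto simp: doubleton_eq_iff)
    moreover have "u * v < 0 \<longleftrightarrow> u * w < 0" using v(3) w(3) \<open>nabs v = nabs w\<close> by simp
    moreover have "u \<noteq> 0" "v \<noteq> 0" using P2_block_facts(4,5)[OF \<pi> v(2)] by auto
    ultimately have "v = w" unfolding nabs_eq_iff by (auto simp: mult_less_0_iff)
    then show ?thesis using v w by simp
  qed
  have part: "partition_on (pm N) (lift \<pi> T)"
  proof (rule partition_onI[OF U])
    show "disjnt B D" if "B \<in> lift \<pi> T" "D \<in> lift \<pi> T" "B \<noteq> D" for B D
      using dis[OF that(1,2)] that(3) by (auto simp: disjnt_def)
    show "{} \<notin> lift \<pi> T" using lift_card[OF \<pi>, of T] by force
  qed
  have bar_in: "bar B \<in> lift \<pi> T" if B: "B \<in> lift \<pi> T" for B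
  proof -
    obtain u v where uv: "B = {u, v}" "{nabs u, nabs v} \<in> \<pi>" "u * v < 0 \<longleftrightarrow> {nabs u, nabs v} \<in> T"
      using liftE[OF B] .
    then have "{- u, - v} \<in> lift \<pi> T" by (simp add: lift_iff)
    then show ?thesis using uv by simp
  qed
  have "bar ` lift \<pi> T = lift \<pi> T"
  proof (intro equalityI subsetI)
    fix B assume "B \<in> lift \<pi> T"
    then have "bar B \<in> lift \<pi> T" "B = bar (bar B)" using bar_in by (auto simp: image_image)
    then show "B \<in> bar ` lift \<pi> T" by (metis imageI)
  qed (use bar_in in auto)
  moreover have "bar B \<noteq> B" if B: "B \<in> lift \<pi> T" for B
  proof -
    obtain u v where uv: "B = {u, v}" "{nabs u, nabs v} \<in> \<pi>" using liftE[OF B] by metis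
    have "- u \<noteq> u" "- u \<noteq> v" using P2_block_facts(4,7)[OF \<pi> uv(2)] by linarith+
    then show ?thesis unfolding uv(1) by auto
  qed
  ultimately show ?thesis
    using part lift_card[OF \<pi>, of T] by (auto simp: P2sym_def P12sym_def singletons_def pairs_def)
qed

text \<open>Recovers the sign set \<open>T\<close> from a lift; the matching itself is recovered by
  taking absolute values.\<close>

definition mixed_pairs :: "int set set \<Rightarrow> nat set set" where
  "mixed_pairs \<tau> = {B. \<exists>u v. {u, v} \<in> \<tau> \<and> u * v < 0 \<and> B = {nabs u, nabs v}}"

lemma P2symD:
  assumes "\<tau> \<in> P2sym N"
  shows "partition_on (pm N) \<tau>" "\<forall>B\<in>\<tau>. card B = 2" "pairs \<tau> = \<tau>"
    "\<And>B. B \<in> \<tau> \<Longrightarrow> bar B \<in> \<tau>" "\<And>B. B \<in> \<tau> \<Longrightarrow> bar B \<noteq> B"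
proof -
  show 2: "\<forall>B\<in>\<tau>. card B = 2" using assms by (auto simp: P2sym_def P12sym_def singletons_def)
  then show 3: "pairs \<tau> = \<tau>" by (auto simp: pairs_def)
  show "partition_on (pm N) \<tau>" using assms by (simp add: P2sym_def P12sym_def)
  show "bar B \<in> \<tau>" if "B \<in> \<tau>" for B
    using that assms by (auto simp: P2sym_def P12sym_def)
  show "bar B \<noteq> B" if "B \<in> \<tau>" for B
    using that assms 3 by (auto simp: P2sym_def P12sym_def)
qed

text \<open>No pair is its own bar, so none has the form \<open>{u, - u}\<close> and absolute values
  give honest pairs. Over each of them lie exactly a pair and its bar, whose products have the same
  sign, so the sign is well defined.\<close>

lemma P2sym_eq_lift:
  assumes \<tau>: "\<tau> \<in> P2sym N"
  defines "\<pi> \<equiv> (`) nabs ` \<tau>"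
  defines "T \<equiv> mixed_pairs \<tau>"
  shows "\<pi> \<in> P2 N" "T \<subseteq> \<pi>" "lift \<pi> T = \<tau>"
proof -
  note T_def = T_def[unfolded mixed_pairs_def]
  note t = P2symD[OF \<tau>]
  have U: "\<Union> \<tau> = pm N" using partition_onD1[OF t(1)] by simp
  have block: "\<exists>u v. B = {u, v} \<and> nabs u \<noteq> nabs v \<and> u \<noteq> 0 \<and> v \<noteq> 0" if "B \<in> \<tau>" for B
  proof -
    obtain u v where uv: "B = {u, v}" "u \<noteq> v" using t(2) \<open>B \<in> \<tau>\<close> by (metis card_2_iff)
    then have "u \<in> pm N" "v \<in> pm N" using U \<open>B \<in> \<tau>\<close> by auto
    then have "u \<noteq> 0" "v \<noteq> 0" by (auto simp: pm_def)
    moreover have "u \<noteq> - v" using t(5)[OF \<open>B \<in> \<tau>\<close>] uv by auto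
    ultimately show ?thesis using uv nabs_eq_iff by metis
  qed
  have neg: "{- u, - v} \<in> \<tau>" if "{u, v} \<in> \<tau>" for u v using t(4)[OF that] by simp
  have same: "{nabs u, nabs v} = {nabs u', nabs v'} \<Longrightarrow> {u', v'} = {u, v} \<or> {u', v'} = {- u, - v}"
    if uv: "{u, v} \<in> \<tau>" and uv': "{u', v'} \<in> \<tau>" for u v u' v'
  proof -
    assume "{nabs u, nabs v} = {nabs u', nabs v'}"
    then have "nabs u \<in> {nabs u', nabs v'}" by auto
    then have "u \<in> {u', v'} \<or> - u \<in> {u', v'}" by (auto simp: nabs_eq_iff)
    then show ?thesis
      using partition_on_unique[OF t(1) uv uv', of u] partition_on_unique[OF t(1) neg[OF uv] uv', of "- u"]
      by auto
  qed
  show \<pi>: "\<pi> \<in> P2 N"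
  proof -
    have "partition_on {1..N} \<pi>"
    proof (rule partition_onI)
      have "\<Union> \<pi> = nabs ` pm N" unfolding \<pi>_def U[symmetric] by auto
      also have "\<dots> = {1..N}"
      proof (intro equalityI subsetI)
        fix a assume "a \<in> {1..N}"
        then have "int a \<in> pm N" by (simp add: pm_def)
        then show "a \<in> nabs ` pm N" by (metis imageI nabs_int(1))
      qed (auto simp: pm_def)
      finally show "\<Union> \<pi> = {1..N}" .
      show "disjnt X Y" if XY: "X \<in> \<pi>" "Y \<in> \<pi>" "X \<noteq> Y" for X Y
      proof (rule ccontr)
        obtain B D where BD: "B \<in> \<tau>" "D \<in> \<tau>" "X = nabs ` B" "Y = nabs ` D" using XY by (auto simp: \<pi>_def)
        assume "\<not> disjnt X Y"
        then obtain u v where uv: "u \<in> B" "v \<in> D" "nabs u = nabs v" using BD by (auto simp: disjnt_def)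
        from uv(3) have "v = u \<or> v = - u" by (auto simp: nabs_eq_iff)
        then have "D = B \<or> D = bar B"
          using partition_on_unique[OF t(1) BD(2,1), of u]
            partition_on_unique[OF t(1) BD(2) t(4)[OF BD(1)], of "- u"] uv by auto
        then have "X = Y" using BD by (auto simp: image_image)
        then show False using XY by simp
      qed
      show "{} \<notin> \<pi>" using partition_onD3[OF t(1)] by (auto simp: \<pi>_def)
    qed
    moreover have "card X = 2" if "X \<in> \<pi>" for X
    proof -
      obtain B where B: "B \<in> \<tau>" "X = nabs ` B" using \<open>X \<in> \<pi>\<close> by (auto simp: \<pi>_def)
      obtain u v where uv: "B = {u, v}" "nabs u \<noteq> nabs v" using block[OF B(1)] by blast
      have "X = {nabs u, nabs v}" unfolding B(2) uv(1) by simp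
      then show ?thesis using uv(2) card_2_iff by blast
    qed
    ultimately show ?thesis by (simp add: P2_def)
  qed
  show T: "T \<subseteq> \<pi>"
  proof
    fix X assume "X \<in> T"
    then obtain u v where "{u, v} \<in> \<tau>" "X = nabs ` {u, v}" unfolding T_def by auto
    then show "X \<in> \<pi>" unfolding \<pi>_def by (metis imageI)
  qed
  have T_iff: "{nabs u, nabs v} \<in> T \<longleftrightarrow> u * v < 0" if uv: "{u, v} \<in> \<tau>" for u v
  proof
    assume "{nabs u, nabs v} \<in> T"
    then obtain u' v' where uv': "{u', v'} \<in> \<tau>" "u' * v' < 0" "{nabs u, nabs v} = {nabs u', nabs v'}"
      unfolding T_def by blast
    then have "{u', v'} = {u, v} \<or> {u', v'} = {- u, - v}" using same[OF uv uv'(1)] by simp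
    then show "u * v < 0" using uv'(2) by (auto simp: doubleton_eq_iff mult.commute)
  qed (use uv in \<open>auto simp: T_def\<close>)
  show "lift \<pi> T = \<tau>"
  proof (intro equalityI subsetI)
    fix B assume "B \<in> \<tau>"
    then obtain u v where uv: "B = {u, v}" using block by blast
    then have "{nabs u, nabs v} \<in> \<pi>" using \<open>B \<in> \<tau>\<close> by (auto simp: \<pi>_def image_iff intro!: bexI[of _ B])
    then show "B \<in> lift \<pi> T" using T_iff[of u v] \<open>B \<in> \<tau>\<close> unfolding uv by (simp add: lift_iff)
  next
    fix B assume "B \<in> lift \<pi> T"
    then obtain u v where uv: "B = {u, v}" "{nabs u, nabs v} \<in> \<pi>" "u * v < 0 \<longleftrightarrow> {nabs u, nabs v} \<in> T"
      by (rule liftE)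
    obtain D where D: "D \<in> \<tau>" "{nabs u, nabs v} = nabs ` D" using uv(2) by (auto simp: \<pi>_def)
    obtain a b where ab: "D = {a, b}" "nabs a = nabs u" "nabs b = nabs v" "a \<noteq> 0" "b \<noteq> 0"
    proof -
      obtain a b where "D = {a, b}" "a \<noteq> 0" "b \<noteq> 0" using block[OF D(1)] by blast
      then show ?thesis using that[of a b] that[of b a] D(2) by (auto simp: doubleton_eq_iff insert_commute)
    qed
    \<comment> \<open>Of the four sign choices over the pair, the sign of the product leaves only
      \<open>(a, b)\<close> and \<open>(- a, - b)\<close>.\<close>
    have sgn: "a * b < 0 \<longleftrightarrow> u * v < 0" using T_iff[of a b] D(1) ab uv(3) by simp
    have "u = a \<or> u = - a" "v = b \<or> v = - b" using ab(2,3) nabs_eq_iff by metis+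
    then consider "u = a" "v = b" | "u = - a" "v = - b" | "u * v = - (a * b)" by fastforce
    then have "B = {a, b} \<or> B = {- a, - b}"
    proof cases
      case 3
      have "a * b \<noteq> 0" using ab(4,5) by simp
      then show ?thesis using sgn 3 by linarith
    qed (simp_all add: uv(1))
    then show "B \<in> \<tau>" using neg[of a b] D(1) ab(1) by auto
  qed
qed

lemma nabs_image_lift:
  assumes \<pi>: "\<pi> \<in> P2 N"
  shows "(`) nabs ` lift \<pi> T = \<pi>"
proof (intro equalityI subsetI)
  fix X assume "X \<in> (`) nabs ` lift \<pi> T"
  then obtain B where "B \<in> lift \<pi> T" "X = nabs ` B" by auto
  then show "X \<in> \<pi>" by (auto elim: liftE)
next
  fix X assume X: "X \<in> \<pi>"
  then obtain a b where ab: "a < b" "X = {a, b}" "1 \<le> a" using P2_block[OF \<pi>] by metis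
  define v where "v = (if X \<in> T then - int b else int b)"
  have "nabs v = b" by (simp add: v_def)
  moreover have "int a * v < 0 \<longleftrightarrow> X \<in> T" using ab by (auto simp: v_def mult_less_0_iff)
  ultimately have "{int a, v} \<in> lift \<pi> T" using X ab by (simp add: lift_iff)
  moreover have "nabs ` {int a, v} = X" using ab \<open>nabs v = b\<close> by simp
  ultimately show "X \<in> (`) nabs ` lift \<pi> T" by (metis imageI)
qed

lemma mixed_pairs_lift:
  assumes \<pi>: "\<pi> \<in> P2 N" and T: "T \<subseteq> \<pi>"
  shows "mixed_pairs (lift \<pi> T) = T"
  unfolding mixed_pairs_def
proof (intro equalityI subsetI)
  fix X assume X: "X \<in> T"
  then obtain a b where ab: "a < b" "X = {a, b}" "1 \<le> a" using P2_block[OF \<pi>] T by (metis subsetD)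
  then have "{int a, - int b} \<in> lift \<pi> T" "int a * - int b < 0" using X T by (auto simp: lift_iff)
  then show "X \<in> {B. \<exists>u v. {u, v} \<in> lift \<pi> T \<and> u * v < 0 \<and> B = {nabs u, nabs v}}"
    using ab(2) by (intro CollectI exI[of _ "int a"] exI[of _ "- int b"]) simp
qed (auto simp: lift_iff)

lemma sum_P2sym:
  fixes g :: "int set set \<Rightarrow> real"
  shows "(\<Sum>\<tau>\<in>P2sym N. g \<tau>) = (\<Sum>\<pi>\<in>P2 N. \<Sum>T\<in>Pow \<pi>. g (lift \<pi> T))"
proof -
  have "(\<Sum>\<pi>\<in>P2 N. \<Sum>T\<in>Pow \<pi>. g (lift \<pi> T)) = (\<Sum>(\<pi>, T)\<in>Sigma (P2 N) Pow. g (lift \<pi> T))"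
    using finite_P2 finite_P2_elem by (intro sum.Sigma) auto
  also have "\<dots> = (\<Sum>\<tau>\<in>P2sym N. g \<tau>)"
  proof (rule sum.reindex_bij_witness[where j = "\<lambda>(\<pi>, T). lift \<pi> T" and
          i = "\<lambda>\<tau>. ((`) nabs ` \<tau>, mixed_pairs \<tau>)"])
    fix z assume "z \<in> Sigma (P2 N) Pow"
    then obtain \<pi> T where z: "z = (\<pi>, T)" "\<pi> \<in> P2 N" "T \<subseteq> \<pi>" by blast
    show "((`) nabs ` (case z of (\<pi>, T) \<Rightarrow> lift \<pi> T), mixed_pairs (case z of (\<pi>, T) \<Rightarrow> lift \<pi> T)) = z"
      using z nabs_image_lift mixed_pairs_lift by simp
    show "(case z of (\<pi>, T) \<Rightarrow> lift \<pi> T) \<in> P2sym N" using z lift_in_P2sym by simp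
    show "g (case z of (\<pi>, T) \<Rightarrow> lift \<pi> T) = (case z of (\<pi>, T) \<Rightarrow> g (lift \<pi> T))" using z by simp
  qed (use P2sym_eq_lift in simp_all)
  finally show ?thesis ..
qed

text \<open>The endpoint of larger absolute value decides: if it is positive, it is the right leg of
  a positive pair, otherwise the left leg of a negative one. That absolute value is the right leg of
  the underlying pair, whatever \<open>T\<close> says.\<close>

lemma lift_legs:
  assumes \<pi>: "\<pi> \<in> P2 N"
  shows "pos_right_legs (lift \<pi> T) = int ` Max ` \<pi>"
    and "neg_left_legs (lift \<pi> T) = uminus ` int ` Max ` \<pi>"
proof -
  have pairs: "pairs (lift \<pi> T) = lift \<pi> T" using P2symD(3)[OF lift_in_P2sym[OF \<pi>]] .
  have pos: "Max B = int (Max (nabs ` B))" if B: "B \<in> lift \<pi> T" "positive B" for B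
  proof -
    obtain u v where uv: "B = {u, v}" "{nabs u, nabs v} \<in> \<pi>" using liftE[OF B(1)] by metis
    then show ?thesis
      using B(2) unfolding uv(1) positive_def by (auto simp: max_def min_def split: if_splits)
  qed
  have neg: "Min B = - int (Max (nabs ` B))" if B: "B \<in> lift \<pi> T" "\<not> positive B" for B
  proof -
    obtain u v where uv: "B = {u, v}" "{nabs u, nabs v} \<in> \<pi>" using liftE[OF B(1)] by metis
    then show ?thesis
      using B(2) unfolding uv(1) positive_def by (auto simp: max_def min_def split: if_splits)
  qed
  have img: "nabs ` B \<in> \<pi>" if "B \<in> lift \<pi> T" for B
    using that nabs_image_lift[OF \<pi>] by blast
  \<comment> \<open>The two pairs over \<open>X\<close>: the one containing
    \<open>int (Max X)\<close> is positive, and its mirror image is negative.\<close>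
  have ex: "\<exists>v. {v, int (Max X)} \<in> lift \<pi> T \<and> {- v, - int (Max X)} \<in> lift \<pi> T \<and> \<bar>v\<bar> < int (Max X)"
    if X: "X \<in> \<pi>" for X
  proof -
    obtain a b where ab: "a < b" "X = {a, b}" "1 \<le> a" "Max X = b" using P2_block[OF \<pi> X] by metis
    define v where "v = (if X \<in> T then - int a else int a)"
    have v: "nabs v = a" "nabs (- v) = a" by (simp_all add: v_def)
    have "v * int b < 0 \<longleftrightarrow> X \<in> T" using ab by (auto simp: v_def mult_less_0_iff)
    then have "{v, int b} \<in> lift \<pi> T" "{- v, - int b} \<in> lift \<pi> T"
      using X ab v unfolding lift_iff by simp_all
    moreover have "\<bar>v\<bar> < int b" using ab by (simp add: v_def)
    ultimately show ?thesis using ab(4) by auto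
  qed
  show "pos_right_legs (lift \<pi> T) = int ` Max ` \<pi>"
    unfolding pos_right_legs_def pairs
  proof (intro equalityI subsetI)
    fix w assume "w \<in> Max ` {B \<in> lift \<pi> T. positive B}"
    then show "w \<in> int ` Max ` \<pi>" using pos img by auto
  next
    fix w assume "w \<in> int ` Max ` \<pi>"
    then obtain X where X: "X \<in> \<pi>" "w = int (Max X)" by auto
    then obtain v where v: "{v, w} \<in> lift \<pi> T" "\<bar>v\<bar> < w" using ex[OF X(1)] by blast
    then have "positive {v, w}" "Max {v, w} = w" by (auto simp: positive_def max_def min_def)
    then show "w \<in> Max ` {B \<in> lift \<pi> T. positive B}" using v(1) by (metis (mono_tags, lifting) imageI mem_Collect_eq)
  qed
  show "neg_left_legs (lift \<pi> T) = uminus ` int ` Max ` \<pi>"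
    unfolding neg_left_legs_def pairs
  proof (intro equalityI subsetI)
    fix w assume "w \<in> Min ` {B \<in> lift \<pi> T. \<not> positive B}"
    then show "w \<in> uminus ` int ` Max ` \<pi>" using neg img by auto
  next
    fix w assume "w \<in> uminus ` int ` Max ` \<pi>"
    then obtain X where X: "X \<in> \<pi>" "w = - int (Max X)" by auto
    then obtain v where v: "{- v, w} \<in> lift \<pi> T" "\<bar>v\<bar> < - w" using ex[OF X(1)] by auto
    then have "\<not> positive {- v, w}" "Min {- v, w} = w" by (auto simp: positive_def max_def min_def)
    then show "w \<in> Min ` {B \<in> lift \<pi> T. \<not> positive B}" using v(1) by (metis (mono_tags, lifting) imageI mem_Collect_eq)
  qed
qed

text \<open>With all signs positive, the lift is a copy of \<open>\<sigma>\<close> on the positive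
  numbers and a mirror copy on the negative ones. Negation reverses the order, so in the mirror copy
  a crossing appears with the two pairs exchanged.\<close>

lemma noncrossing_lift:
  assumes \<sigma>: "\<sigma> \<in> P2 N" and nc: "noncrossing \<sigma>"
  shows "noncrossing (lift \<sigma> {})"
proof (rule noncrossingI)
  fix B C a b c d
  assume B: "B \<in> lift \<sigma> {}" and C: "C \<in> lift \<sigma> {}" and ne: "B \<noteq> C"
    and mem: "a \<in> B" "b \<in> C" "c \<in> B" "d \<in> C" and less: "a < b" "b < c" "c < d"
  have sgn: "{x, y} = X \<and> {nabs x, nabs y} \<in> \<sigma> \<and> 0 < x * y"
    if X: "X \<in> lift \<sigma> {}" "x \<in> X" "y \<in> X" "x \<noteq> y" for X x y
  proof -
    obtain v where v: "X = {x, v}" "{nabs x, nabs v} \<in> \<sigma>" "\<not> x * v < 0"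
      using lift_blockE[OF X(1,2)] by (metis empty_iff)
    moreover have "y = v" using v(1) X(3,4) by auto
    moreover have "x \<noteq> 0" "v \<noteq> 0" using P2_block_facts(4,5)[OF \<sigma> v(2)] by auto
    then have "x * v \<noteq> 0" by simp
    ultimately show ?thesis by auto
  qed
  have ac: "{a, c} = B" "{nabs a, nabs c} \<in> \<sigma>" "0 < a * c" using sgn[OF B mem(1,3)] less by auto
  have bd: "{b, d} = C" "{nabs b, nabs d} \<in> \<sigma>" "0 < b * d" using sgn[OF C mem(2,4)] less by auto
  have ne': "{nabs a, nabs c} \<noteq> {nabs b, nabs d}" if "0 < a \<longleftrightarrow> 0 < b"
    using that less ac(3) bd(3) by (auto simp: doubleton_eq_iff zero_less_mult_iff)
  consider "0 < a" "0 < b" "0 < c" "0 < d" | "a < 0" "b < 0" "c < 0" "d < 0"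
    using ac(3) bd(3) less by (auto simp: zero_less_mult_iff)
  then show False
  proof cases
    case 1
    then show False
      using noncrossingD[OF nc ac(2) bd(2) ne', of "nabs a" "nabs b" "nabs c" "nabs d"] less by auto
  next
    case 2
    then show False
      using noncrossingD[OF nc bd(2) ac(2) ne'[symmetric], of "nabs d" "nabs c" "nabs b" "nabs a"] less
      by auto
  qed
qed

text \<open>The legs force at least \<open>card \<pi>\<close> positive and \<open>card \<pi>\<close>
  negative pairs. These already cover all \<open>2 * N\<close> points, so there is no singleton and
  \<open>\<tau>\<close> is a lift. Being non-crossing, it has no mixed pair.\<close>

lemma hat_sym_unique:
  assumes \<pi>: "\<pi> \<in> P2 N" and \<tau>: "\<tau> \<in> P12sym N" and nc: "noncrossing \<tau>"
    and legs: "pos_right_legs \<tau> = int ` Max ` \<pi>" "neg_left_legs \<tau> = uminus ` int ` Max ` \<pi>"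
  shows "\<tau> = lift (hat_matching N \<pi>) {}"
proof -
  have part: "partition_on (pm N) \<tau>" and card: "\<forall>B\<in>\<tau>. card B = 1 \<or> card B = 2"
    using \<tau> by (auto simp: P12sym_def)
  have fin: "finite \<tau>" using finite_elements[OF finite_pm part] .
  have fin\<pi>: "finite \<pi>" using finite_P2_elem[OF \<pi>] .
  define Pp where "Pp = {B \<in> pairs \<tau>. positive B}"
  define Pn where "Pn = {B \<in> pairs \<tau>. \<not> positive B}"
  have finP: "finite Pp" "finite Pn" using fin by (auto simp: Pp_def Pn_def pairs_def)
  have cm: "card (Max ` \<pi>) = card \<pi>"
    using legs_matchings[OF P2_in_matchings(1)[OF \<pi>]] matchings_card_eq[OF P2_in_matchings(1)[OF \<pi>]]
      finite_subset[OF P2_in_matchings(2)[OF \<pi>]] by auto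
  have "card (int ` Max ` \<pi>) = card \<pi>" using cm by (simp add: card_image)
  moreover have "card (uminus ` int ` Max ` \<pi>) = card (int ` Max ` \<pi>)" by (rule card_image) auto
  ultimately have "card \<pi> \<le> card Pp" "card \<pi> \<le> card Pn"
    using legs card_image_le[OF finP(1), of Max] card_image_le[OF finP(2), of Min]
    unfolding pos_right_legs_def neg_left_legs_def Pp_def Pn_def by auto
  moreover have "card (pairs \<tau>) = card Pp + card Pn"
  proof -
    have "pairs \<tau> = Pp \<union> Pn" "Pp \<inter> Pn = {}" by (auto simp: Pp_def Pn_def)
    then show ?thesis using finP by (simp add: card_Un_disjoint)
  qed
  moreover have "N = 2 * card \<pi>" using card_matching[OF P2_partition[OF \<pi>] P2_card[OF \<pi>]] by simp
  ultimately have "N \<le> card (pairs \<tau>)" by simp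
  moreover have "card (\<Union> (pairs \<tau>)) = 2 * card (pairs \<tau>)"
  proof (rule card_matching)
    show "partition_on (\<Union> (pairs \<tau>)) (pairs \<tau>)"
      using part by (auto simp: partition_on_def pairs_def disjoint_def)
  qed (auto simp: pairs_def)
  moreover have sub: "\<Union> (pairs \<tau>) \<subseteq> pm N" using partition_onD1[OF part] by (auto simp: pairs_def)
  ultimately have U: "\<Union> (pairs \<tau>) = pm N"
    using card_seteq[OF finite_pm sub] card_pm[of N] by simp
  have "singletons \<tau> = {}"
  proof (rule equals0I)
    fix B assume "B \<in> singletons \<tau>"
    then have B: "B \<in> \<tau>" "card B = 1" by (auto simp: singletons_def)
    then obtain u where u: "u \<in> B" by fastforce
    then have "u \<in> \<Union> (pairs \<tau>)" using U B partition_onD1[OF part] by auto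
    then obtain D where "D \<in> \<tau>" "card D = 2" "u \<in> D" by (auto simp: pairs_def)
    then show False using partition_on_unique[OF part B(1), of D u] u B by auto
  qed
  then have sym: "\<tau> \<in> P2sym N" using \<tau> by (simp add: P2sym_def)
  obtain \<pi>' T where \<pi>': "\<pi>' \<in> P2 N" and T: "T \<subseteq> \<pi>'" and lift: "\<tau> = lift \<pi>' T"
    using P2sym_eq_lift[OF sym] by metis
  have "T = {}"
  proof (rule equals0I)
    fix X assume X: "X \<in> T"
    then have X': "X \<in> \<pi>'" using T by blast
    obtain a b where ab: "a < b" "X = {a, b}" "1 \<le> a" using P2_block[OF \<pi>' X'] by metis
    \<comment> \<open>A mixed pair crosses its own bar, because
      \<open>- b < - a < a < b\<close>.\<close>
    have "{- int b, int a} \<in> \<tau>" "{- int a, int b} \<in> \<tau>"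
      using X X' ab unfolding lift lift_iff by (auto simp: mult_less_0_iff insert_commute)
    moreover have "{- int b, int a} \<noteq> {- int a, int b}" using ab by (auto simp: doubleton_eq_iff)
    ultimately show False
      using noncrossingD[OF nc, of "{- int b, int a}" "{- int a, int b}" "- int b" "- int a" "int a" "int b"] ab
      by simp
  qed
  have "noncrossing \<pi>'"
  proof (rule noncrossingI)
    fix B C a b c d
    assume B: "B \<in> \<pi>'" and C: "C \<in> \<pi>'" and ne: "B \<noteq> C"
      and mem: "a \<in> B" "b \<in> C" "c \<in> B" "d \<in> C" and less: "a < b" "b < c" "c < d"
    have eq: "B = {a, c}" "C = {b, d}"
      using P2_card[OF \<pi>'] B C mem less by (auto simp: card_2_iff)
    have "{int a, int c} \<in> \<tau>" "{int b, int d} \<in> \<tau>"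
      using B C unfolding lift lift_iff \<open>T = {}\<close> eq by (auto simp: mult_less_0_iff)
    moreover have "{int a, int c} \<noteq> {int b, int d}" using less by (auto simp: doubleton_eq_iff)
    ultimately show False
      using noncrossingD[OF nc, of "{int a, int c}" "{int b, int d}" "int a" "int b" "int c" "int d"] less
      by simp
  qed
  \<comment> \<open>The symmetric legs prescribe the right legs, and the left legs are their
    complement.\<close>
  moreover have "Min ` \<pi>' = Min ` \<pi>"
  proof -
    have "int ` Max ` \<pi>' = int ` Max ` \<pi>" using legs(1) lift_legs(1)[OF \<pi>'] lift by simp
    then have "Max ` \<pi>' = Max ` \<pi>" by (simp add: inj_image_eq_iff)
    then show ?thesis using left_legs_P2[OF \<pi>] left_legs_P2[OF \<pi>'] by simp
  qed
  ultimately have "\<pi>' = hat_matching N \<pi>" using hat_matching_eqI[OF \<pi> \<pi>'] by simp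
  then show ?thesis using lift \<open>T = {}\<close> by simp
qed

lemma hat_sym_lift:
  assumes \<pi>: "\<pi> \<in> P2 N"
  shows "hat_sym N (lift \<pi> T) = lift (hat_matching N \<pi>) {}"
  unfolding hat_sym_def
proof (rule the_equality)
  let ?\<tau> = "lift (hat_matching N \<pi>) {}"
  note hat = hat_matching[OF \<pi>]
  have sym: "?\<tau> \<in> P2sym N" using lift_in_P2sym[OF hat(1)] .
  have Max_eq: "Max ` hat_matching N \<pi> = Max ` \<pi>"
    using right_legs_P2[OF \<pi>] right_legs_P2[OF hat(1)] hat(3) by simp
  show "?\<tau> \<in> P12sym N \<and> noncrossing ?\<tau> \<and> pos_right_legs ?\<tau> = pos_right_legs (lift \<pi> T) \<and>
      neg_left_legs ?\<tau> = neg_left_legs (lift \<pi> T) \<and>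
      \<not> (\<exists>B\<in>pairs ?\<tau>. \<exists>s. {s} \<in> ?\<tau> \<and> left_leg B < s \<and> s < right_leg B)"
  proof (intro conjI)
    show "?\<tau> \<in> P12sym N" using sym by (simp add: P2sym_def)
    show "noncrossing ?\<tau>" using noncrossing_lift[OF hat(1,2)] .
    have "{s} \<notin> ?\<tau>" for s using P2symD(2)[OF sym] by force
    then show "\<not> (\<exists>B\<in>pairs ?\<tau>. \<exists>s. {s} \<in> ?\<tau> \<and> left_leg B < s \<and> s < right_leg B)" by blast
  qed (simp_all add: lift_legs[OF \<pi>] lift_legs[OF hat(1)] Max_eq)
  fix \<tau> assume "\<tau> \<in> P12sym N \<and> noncrossing \<tau> \<and> pos_right_legs \<tau> = pos_right_legs (lift \<pi> T) \<and>
      neg_left_legs \<tau> = neg_left_legs (lift \<pi> T) \<and>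
      \<not> (\<exists>B\<in>pairs \<tau>. \<exists>s. {s} \<in> \<tau> \<and> left_leg B < s \<and> s < right_leg B)"
  then show "\<tau> = ?\<tau>" using hat_sym_unique[OF \<pi>] lift_legs[OF \<pi>] by simp
qed

section \<open>Components of the double cover of a cycle graph\<close>

locale double_cover =
  fixes N :: nat and \<pi> \<sigma> T :: "nat set set"
  assumes \<pi>: "\<pi> \<in> P2 N" and \<sigma>: "\<sigma> \<in> P2 N"
begin

definition E :: "int set set" where "E = lift \<pi> T \<union> lift \<sigma> {}"

text \<open>The components over \<open>C\<close>. Their set turns out to be
  \<open>{S, bar S}\<close>, the very encoding used for cycles, so \<open>above\<close> will be the
  bijection from base components to cycles.\<close>

definition above :: "nat set \<Rightarrow> int set set" where
  "above C = {S \<in> components (pm N) E. nabs ` S = C}"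

lemma base_Union: "\<Union> (\<pi> \<union> \<sigma>) \<subseteq> {1..N}"
  using P2_Union[OF \<pi>] P2_Union[OF \<sigma>] by auto

lemma lift_Union: "\<Union> (lift \<pi> T) = pm N" "\<Union> (lift \<sigma> {}) = pm N"
  using partition_onD1[OF P2symD(1)[OF lift_in_P2sym]] \<pi> \<sigma> by metis+

lemma E_Union: "\<Union> E \<subseteq> pm N"
  using lift_Union by (auto simp: E_def)

lemma connected_uminus: "(u, v) \<in> (adjacency E)\<^sup>* \<Longrightarrow> (- u, - v) \<in> (adjacency E)\<^sup>*"
proof (rule connected_map[where \<rho> = uminus])
  fix B u v assume "B \<in> E" "u \<in> B" "v \<in> B"
  then have "bar B \<in> E"
    using P2symD(4)[OF lift_in_P2sym[OF \<pi>]] P2symD(4)[OF lift_in_P2sym[OF \<sigma>]] by (auto simp: E_def)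
  then show "(- u, - v) \<in> (adjacency E)\<^sup>*"
    using \<open>u \<in> B\<close> \<open>v \<in> B\<close> by (intro adjacent_connected[of "bar B"]) auto
qed

lemma connected_nabs: "(u, v) \<in> (adjacency E)\<^sup>* \<Longrightarrow> (nabs u, nabs v) \<in> (adjacency (\<pi> \<union> \<sigma>))\<^sup>*"
proof (rule connected_map[where \<rho> = nabs])
  fix B u v assume "B \<in> E" "u \<in> B" "v \<in> B"
  then have "nabs ` B \<in> \<pi> \<union> \<sigma>" using nabs_image_lift[OF \<pi>] nabs_image_lift[OF \<sigma>] unfolding E_def by blast
  then show "(nabs u, nabs v) \<in> (adjacency (\<pi> \<union> \<sigma>))\<^sup>*"
    using \<open>u \<in> B\<close> \<open>v \<in> B\<close> by (intro adjacent_connected[of "nabs ` B"]) auto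
qed

text \<open>Path lifting for one edge from a prescribed starting point: a lift of the edge starts at
  \<open>u\<close> or at \<open>- u\<close>, and in the latter case its bar starts at
  \<open>u\<close>.\<close>

lemma lift_edge:
  assumes \<rho>: "\<rho> \<in> P2 N" and B: "B \<in> \<rho>" "nabs u \<in> B" "b \<in> B"
  obtains v where "nabs v = b" "(u, v) \<in> (adjacency (lift \<rho> S))\<^sup>*"
proof (cases "nabs u = b")
  case True
  then show ?thesis using that by blast
next
  case False
  obtain D where D: "D \<in> lift \<rho> S" "B = nabs ` D" using nabs_image_lift[OF \<rho>, of S] B(1) by blast
  obtain u' v' where uv: "u' \<in> D" "v' \<in> D" "nabs u' = nabs u" "nabs v' = b" using D(2) B(2,3) by auto
  show ?thesis
  proof (cases "u' = u")
    case True
    then show ?thesis using that[OF uv(4)] adjacent_connected[OF D(1) uv(1,2)] by simp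
  next
    case False
    then have "u = - u'" using uv(3) nabs_eq_iff by metis
    moreover have "bar D \<in> lift \<rho> S" using P2symD(4)[OF lift_in_P2sym[OF \<rho>]] D(1) by blast
    ultimately have "(u, - v') \<in> (adjacency (lift \<rho> S))\<^sup>*"
      using adjacent_connected[of "bar D" _ u "- v'"] uv(1,2) by blast
    then show ?thesis using that[of "- v'"] uv(4) by simp
  qed
qed

lemma connected_lift:
  assumes "(nabs u, b) \<in> (adjacency (\<pi> \<union> \<sigma>))\<^sup>*"
  obtains v where "nabs v = b" "(u, v) \<in> (adjacency E)\<^sup>*"
proof -
  have "\<exists>v. nabs v = b \<and> (u, v) \<in> (adjacency E)\<^sup>*"
    using assms
  proof (induction rule: rtrancl_induct)
    case base
    then show ?case by blast
  next
    case (step y z)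
    then obtain v where v: "nabs v = y" "(u, v) \<in> (adjacency E)\<^sup>*" by blast
    obtain B where B: "B \<in> \<pi> \<union> \<sigma>" "nabs v \<in> B" "z \<in> B"
      using step.hyps(2) v(1) by (auto simp: adjacency_def)
    have mono: "(adjacency (lift \<pi> T))\<^sup>* \<subseteq> (adjacency E)\<^sup>*" "(adjacency (lift \<sigma> {}))\<^sup>* \<subseteq> (adjacency E)\<^sup>*"
      by (intro rtrancl_mono; auto simp: adjacency_def E_def)+
    obtain w where "nabs w = z" "(v, w) \<in> (adjacency E)\<^sup>*"
    proof (cases "B \<in> \<pi>")
      case True
      obtain w where "nabs w = z" "(v, w) \<in> (adjacency (lift \<pi> T))\<^sup>*"
        using lift_edge[OF \<pi> True B(2,3)] .
      then show ?thesis using that mono(1) by blast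
    next
      case False
      then have "B \<in> \<sigma>" using B(1) by blast
      obtain w where "nabs w = z" "(v, w) \<in> (adjacency (lift \<sigma> {}))\<^sup>*"
        using lift_edge[OF \<sigma> \<open>B \<in> \<sigma>\<close> B(2,3)] .
      then show ?thesis using that mono(2) by blast
    qed
    then show ?case using v(2) rtrancl_trans by metis
  qed
  then show ?thesis using that by blast
qed

lemma nabs_component:
  assumes u: "u \<in> pm N"
  shows "nabs ` component (pm N) E u = component {1..N} (\<pi> \<union> \<sigma>) (nabs u)"
proof (intro equalityI subsetI)
  fix b assume "b \<in> nabs ` component (pm N) E u"
  then obtain v where v: "v \<in> pm N" "(u, v) \<in> (adjacency E)\<^sup>*" "b = nabs v"
    by (auto simp: component_def)
  then show "b \<in> component {1..N} (\<pi> \<union> \<sigma>) (nabs u)"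
    using connected_nabs[OF v(2)] pm_iff[of v N] by (simp add: component_def)
next
  fix b assume b: "b \<in> component {1..N} (\<pi> \<union> \<sigma>) (nabs u)"
  then obtain v where v: "nabs v = b" "(u, v) \<in> (adjacency E)\<^sup>*"
    using connected_lift[of u b] by (auto simp: component_def)
  then have "v \<in> pm N" using b pm_iff[of v N] by (simp add: component_def)
  then show "b \<in> nabs ` component (pm N) E u" using v by (auto simp: component_def)
qed

lemma bar_component: "bar (component (pm N) E u) = component (pm N) E (- u)"
proof -
  have sub: "bar (component (pm N) E u) \<subseteq> component (pm N) E (- u)" for u
    using connected_uminus by (auto simp: component_def pm_def)
  have "component (pm N) E (- u) = bar (bar (component (pm N) E (- u)))" by (simp add: image_image)
  also have "\<dots> \<subseteq> bar (component (pm N) E u)" using sub[of "- u"] by (intro image_mono) simp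
  finally show ?thesis using sub[of u] by blast
qed

lemma nabs_components: "S \<in> components (pm N) E \<Longrightarrow> nabs ` S \<in> components {1..N} (\<pi> \<union> \<sigma>)"
proof -
  assume "S \<in> components (pm N) E"
  then obtain u where u: "u \<in> pm N" "S = component (pm N) E u" by (auto simp: components_eq)
  moreover have "nabs u \<in> {1..N}" using u(1) pm_iff by blast
  ultimately show ?thesis using nabs_component[OF u(1)] unfolding components_eq by blast
qed

text \<open>A component over \<open>C\<close> contains one of the two points \<open>u\<close> and
  \<open>- u\<close> over a chosen point of \<open>C\<close>, so it is \<open>S\<close> or
  \<open>bar S\<close>. Two components are equal or disjoint, hence the final alternative.\<close>

lemma above_eq:
  assumes C: "C \<in> components {1..N} (\<pi> \<union> \<sigma>)"
  obtains S where "S \<in> components (pm N) E" "nabs ` S = C" "above C = {S, bar S}" "bar S \<inter> S = {} \<or> bar S = S"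
proof -
  obtain a where a: "a \<in> {1..N}" "C = component {1..N} (\<pi> \<union> \<sigma>) a" using C by (auto simp: components_eq)
  define u where "u = int a"
  have u: "u \<in> pm N" "- u \<in> pm N" "nabs u = a" using a(1) by (auto simp: u_def pm_def)
  define S where "S = component (pm N) E u"
  have S: "S \<in> components (pm N) E" "bar S \<in> components (pm N) E"
    using u unfolding S_def bar_component components_eq by auto
  have SC: "nabs ` S = C" using nabs_component[OF u(1)] a(2) u(3) S_def by simp
  have "nabs ` bar S = C" using SC by (simp add: image_image)
  moreover have "S' = S \<or> S' = bar S" if "S' \<in> components (pm N) E" "nabs ` S' = C" for S'
  proof -
    have "a \<in> nabs ` S'" using that(2) a component_self by metis
    then obtain v where v: "v \<in> S'" "nabs v = nabs u" using u(3) by auto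
    then have "S' = component (pm N) E v" using components_eqI[OF that(1)] by blast
    then show ?thesis using v(2) nabs_eq_iff unfolding S_def bar_component by metis
  qed
  ultimately have "above C = {S, bar S}" using S SC unfolding above_def by blast
  moreover have "bar S \<inter> S = {} \<or> bar S = S" using disjointD[OF disjoint_components S(2,1)] by blast
  ultimately show ?thesis using that S(1) SC by blast
qed

lemma above_component:
  assumes S: "S \<in> components (pm N) E"
  shows "above (nabs ` S) = {S, bar S}"
proof -
  obtain S' where S': "above (nabs ` S) = {S', bar S'}" using above_eq[OF nabs_components[OF S]] by metis
  have "S \<in> above (nabs ` S)" using S by (simp add: above_def)
  then consider "S = S'" | "S = bar S'" using S' by blast
  then show ?thesis
  proof cases
    case 2
    then have "bar S = S'" by (simp add: image_image)
    then show ?thesis using S' 2 by (simp add: insert_commute)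
  qed (use S' in simp)
qed

lemma edge_component:
  assumes "S \<in> components (pm N) E" "{u, v} \<in> E"
  shows "u \<in> S \<longleftrightarrow> v \<in> S"
  using component_cases[OF E_Union assms] by auto

text \<open>A labelling that explains the signs is the same thing as a choice of one of the two
  sheets over \<open>C\<close>, and the sheets can be separated exactly if the cover over
  \<open>C\<close> splits.\<close>

lemma balanced_iff:
  assumes S: "S \<in> components (pm N) E"
  shows "balanced \<pi> \<sigma> T (nabs ` S) \<longleftrightarrow> bar S \<inter> S = {}"
proof
  let ?C = "nabs ` S"
  have C: "?C \<in> components {1..N} (\<pi> \<union> \<sigma>)" using nabs_components[OF S] .
  assume "balanced \<pi> \<sigma> T ?C"
  then obtain A where "(\<forall>B\<in>\<sigma>. B \<subseteq> ?C \<longrightarrow> B \<subseteq> A \<or> B \<inter> A = {}) \<and>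
     (\<forall>B\<in>\<pi>. B \<subseteq> ?C \<longrightarrow> (B \<in> T \<longleftrightarrow> \<not> (B \<subseteq> A \<or> B \<inter> A = {})))"
    unfolding balanced_def by (elim exE conjE) (rule that, rule conjI)
  then have A\<sigma>: "\<And>B. B \<in> \<sigma> \<Longrightarrow> B \<subseteq> ?C \<Longrightarrow> B \<subseteq> A \<or> B \<inter> A = {}"
    and A\<pi>: "\<And>B. B \<in> \<pi> \<Longrightarrow> B \<subseteq> ?C \<Longrightarrow> B \<in> T \<longleftrightarrow> \<not> (B \<subseteq> A \<or> B \<inter> A = {})"
    by simp_all
  \<comment> \<open>The sheet chosen by \<open>A\<close>: over a point of \<open>C\<close> the
    positive number if the point is in \<open>A\<close>, and the negative one otherwise. No edge
    leaves \<open>D\<close>, but \<open>D\<close> contains exactly one of \<open>v\<close> and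
    \<open>- v\<close>, so these are not connected.\<close>
  define D where "D = {u. nabs u \<in> ?C \<and> (nabs u \<in> A \<longleftrightarrow> 0 < u)}"
  have edge: "u \<in> D \<longleftrightarrow> v \<in> D" if uv: "{u, v} \<in> E" for u v
  proof -
    have in_base: "{nabs u, nabs v} \<in> \<pi> \<union> \<sigma>" using uv by (auto simp: E_def lift_iff)
    have nz: "u \<noteq> 0" "v \<noteq> 0" using in_base P2_block_facts(4,5) \<pi> \<sigma> by blast+
    have "{nabs u, nabs v} \<subseteq> ?C \<or> {nabs u, nabs v} \<inter> ?C = {}"
      using component_cases[OF base_Union C in_base] .
    moreover have "(nabs u \<in> A \<longleftrightarrow> 0 < u) \<longleftrightarrow> (nabs v \<in> A \<longleftrightarrow> 0 < v)" if sub: "{nabs u, nabs v} \<subseteq> ?C"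
    proof -
      consider "{u, v} \<in> lift \<pi> T" | "{u, v} \<in> lift \<sigma> {}" using uv by (auto simp: E_def)
      then have "u * v < 0 \<longleftrightarrow> \<not> (nabs u \<in> A \<longleftrightarrow> nabs v \<in> A)"
      proof cases
        case 1
        then have "{nabs u, nabs v} \<in> \<pi>" "u * v < 0 \<longleftrightarrow> {nabs u, nabs v} \<in> T" by (simp_all add: lift_iff)
        then show ?thesis using A\<pi>[of "{nabs u, nabs v}"] sub by auto
      next
        case 2
        then have "{nabs u, nabs v} \<in> \<sigma>" "\<not> u * v < 0" by (simp_all add: lift_iff)
        then show ?thesis using A\<sigma>[of "{nabs u, nabs v}"] sub by auto
      qed
      moreover have "u * v < 0 \<longleftrightarrow> \<not> (0 < u \<longleftrightarrow> 0 < v)" using nz by (auto simp: mult_less_0_iff)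
      ultimately show ?thesis by blast
    qed
    ultimately show ?thesis unfolding D_def by blast
  qed
  have closed: "B \<subseteq> D \<or> B \<inter> D = {}" if B: "B \<in> E" for B
  proof -
    obtain u v where uv: "B = {u, v}" using B unfolding E_def by (auto elim: liftE)
    show ?thesis using edge[of u v] B unfolding uv by auto
  qed
  show "bar S \<inter> S = {}"
  proof (rule equals0I)
    fix v assume "v \<in> bar S \<inter> S"
    then have v: "v \<in> S" "- v \<in> S" by auto
    then have nz: "v \<noteq> 0" "nabs v \<in> ?C" using components_subset[OF S] by (auto simp: pm_def)
    have vv: "(v, - v) \<in> (adjacency E)\<^sup>*" using components_eqI[OF S v(1)] v(2) by (simp add: component_def)
    have "v \<in> D \<longleftrightarrow> - v \<in> D"
      by (rule iffI) (rule connected_closed[of E D, OF closed]; use vv connected_sym[OF vv] in blast)+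
    then show False using nz by (auto simp: D_def)
  qed
next
  let ?C = "nabs ` S"
  assume dis: "bar S \<inter> S = {}"
  \<comment> \<open>The labels are read off from \<open>S\<close>: since \<open>S\<close> and
    \<open>bar S\<close> are disjoint, \<open>S\<close> contains exactly one of the two numbers over
    each point of \<open>?C\<close>.\<close>
  define A where "A = {a \<in> ?C. int a \<in> S}"
  have sign: "- int a \<in> S \<longleftrightarrow> a \<notin> A" if a: "a \<in> ?C" for a
  proof -
    obtain u where u: "u \<in> S" "a = nabs u" using a by blast
    then have "int a \<in> S \<or> - int a \<in> S" by (cases "u < 0") auto
    moreover have "\<not> (int a \<in> S \<and> - int a \<in> S)" using dis by (metis disjoint_iff image_eqI)
    ultimately show ?thesis using a by (auto simp: A_def)
  qed
  have A_iff: "a \<in> A \<longleftrightarrow> int a \<in> S" if "a \<in> ?C" for a using that by (simp add: A_def)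
  show "balanced \<pi> \<sigma> T ?C"
    unfolding balanced_def
  proof (intro exI[of _ A] conjI ballI impI)
    show "A \<subseteq> ?C" by (auto simp: A_def)
    show "B \<subseteq> A \<or> B \<inter> A = {}" if B: "B \<in> \<sigma>" "B \<subseteq> ?C" for B
    proof -
      obtain a b where ab: "B = {a, b}" using P2_block[OF \<sigma> B(1)] by metis
      have "\<not> int a * int b < 0" by (simp add: mult_less_0_iff)
      then have "{int a, int b} \<in> E" using B(1) ab by (simp add: E_def lift_iff)
      then have "a \<in> A \<longleftrightarrow> b \<in> A" using edge_component[OF S] A_iff B(2) ab by auto
      then show ?thesis unfolding ab by auto
    qed
    show "B \<in> T \<longleftrightarrow> \<not> (B \<subseteq> A \<or> B \<inter> A = {})" if B: "B \<in> \<pi>" "B \<subseteq> ?C" for B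
    proof -
      obtain a b where ab: "B = {a, b}" "a < b" "1 \<le> a" using P2_block[OF \<pi> B(1)] by metis
      have "B \<in> T \<longleftrightarrow> \<not> (a \<in> A \<longleftrightarrow> b \<in> A)"
      proof (cases "B \<in> T")
        case True
        have "int a * - int b < 0" using ab by (simp add: mult_less_0_iff)
        then have "{int a, - int b} \<in> E" using B(1) ab True by (simp add: E_def lift_iff)
        then have "a \<in> A \<longleftrightarrow> b \<notin> A" using edge_component[OF S] A_iff sign B(2) ab by auto
        then show ?thesis using True by blast
      next
        case False
        have "\<not> int a * int b < 0" by (simp add: mult_less_0_iff)
        then have "{int a, int b} \<in> E" using B(1) ab False by (simp add: E_def lift_iff)
        then have "a \<in> A \<longleftrightarrow> b \<in> A" using edge_component[OF S] A_iff B(2) ab by auto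
        then show ?thesis using False by blast
      qed
      then show ?thesis unfolding ab by auto
    qed
  qed
qed

lemma card_above:
  assumes S: "S \<in> components (pm N) E"
  shows "bar S \<inter> S = {} \<Longrightarrow> card S = card (nabs ` S)" "bar S = S \<Longrightarrow> card S = 2 * card (nabs ` S)"
proof -
  have "S \<subseteq> pm N" using components_subset[OF S] .
  then have fin: "finite S" using finite_pm finite_subset by blast
  show "card S = card (nabs ` S)" if dis: "bar S \<inter> S = {}"
  proof -
    have "inj_on nabs S"
    proof (rule inj_onI)
      fix u v assume uv: "u \<in> S" "v \<in> S" "nabs u = nabs v"
      then have "u = v \<or> u = - v" using nabs_eq_iff by metis
      then show "u = v" using dis uv(1,2) by blast
    qed
    then show ?thesis by (simp add: card_image)
  qed
  show "card S = 2 * card (nabs ` S)" if bar: "bar S = S"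
  proof -
    let ?C = "nabs ` S"
    have nz: "u \<noteq> 0" if "u \<in> S" for u using \<open>S \<subseteq> pm N\<close> that by (auto simp: pm_def)
    have neg: "- u \<in> S" if "u \<in> S" for u using bar that by blast
    have "S = int ` ?C \<union> uminus ` int ` ?C"
    proof (intro equalityI subsetI)
      fix u assume "u \<in> S"
      then have "nabs u \<in> ?C" "u = int (nabs u) \<or> u = - int (nabs u)" by auto
      then show "u \<in> int ` ?C \<union> uminus ` int ` ?C" by blast
    next
      fix u assume "u \<in> int ` ?C \<union> uminus ` int ` ?C"
      then obtain v where v: "v \<in> S" "u = int (nabs v) \<or> u = - int (nabs v)" by blast
      then have "u = v \<or> u = - v" by auto
      then show "u \<in> S" using v(1) neg by blast
    qed
    moreover have "int ` ?C \<inter> uminus ` int ` ?C = {}"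
    proof (rule equals0I)
      fix w assume "w \<in> int ` ?C \<inter> uminus ` int ` ?C"
      then obtain u v where "u \<in> S" "\<bar>u\<bar> = - \<bar>v\<bar>" by auto
      then show False using nz[of u] by linarith
    qed
    moreover have "card (int ` ?C) = card ?C" by (rule card_image) auto
    moreover have "card (uminus ` int ` ?C) = card (int ` ?C)" by (rule card_image) auto
    ultimately have "card S = card ?C + card ?C" using fin card_Un_disjoint by (metis finite_imageI)
    then show ?thesis by simp
  qed
qed

lemma above_inj: "inj_on above (components {1..N} (\<pi> \<union> \<sigma>))"
proof (rule inj_onI)
  fix C D assume "C \<in> components {1..N} (\<pi> \<union> \<sigma>)" "D \<in> components {1..N} (\<pi> \<union> \<sigma>)" and eq: "above C = above D"
  obtain S where "nabs ` S = C" "above C = {S, bar S}" using above_eq[OF \<open>C \<in> _\<close>] by metis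
  then have "S \<in> above D" using eq by blast
  then show "C = D" using \<open>nabs ` S = C\<close> by (simp add: above_def)
qed

end

text \<open>Cycles correspond to base components through \<open>above\<close>, the negative ones to
  the unbalanced components. A component over a balanced \<open>C\<close> has as many points as
  \<open>C\<close>; over an unbalanced \<open>C\<close> it has twice as many, which the halving in
  the length of a negative cycle compensates. So every length is \<open>card C div 2\<close>, and
  only \<open>c_minus\<close> depends on \<open>T\<close>.\<close>

lemma cycles_lift:
  assumes \<pi>: "\<pi> \<in> P2 N"
  defines "\<C> \<equiv> components {1..N} (\<pi> \<union> hat_matching N \<pi>)"
  shows "c_minus N (lift \<pi> T) = card {C \<in> \<C>. \<not> balanced \<pi> (hat_matching N \<pi>) T C}"
    and "l_c N (lift \<pi> T) = (\<Sum>C\<in>\<C>. card C div 2 - 1)"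
proof -
  let ?\<sigma> = "hat_matching N \<pi>" and ?\<tau> = "lift \<pi> T"
  note \<sigma> = hat_matching(1)[OF \<pi>]
  interpret double_cover N \<pi> ?\<sigma> T by unfold_locales (rule \<pi>, rule \<sigma>)
  have pairs: "pairs ?\<tau> = ?\<tau>" using P2symD(3)[OF lift_in_P2sym[OF \<pi>]] .
  have pairs_hat: "pairs (hat_sym N ?\<tau>) = lift ?\<sigma> {}"
    unfolding hat_sym_lift[OF \<pi>] using P2symD(3)[OF lift_in_P2sym[OF \<sigma>]] .
  \<comment> \<open>Both lifted matchings cover all of \<open>pm N\<close>, so there are neither
    open paths nor isolated points.\<close>
  have closed: "closed_components N ?\<tau> = components (pm N) E"
    unfolding closed_components_def pairs_hat pairs E_def[symmetric] lift_Union
    using components_subset[of _ "pm N" E] by blast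
  have neg: "neg_cycles N ?\<tau> = above ` {C \<in> \<C>. \<not> balanced \<pi> ?\<sigma> T C}"
  proof (intro equalityI subsetI)
    fix X assume "X \<in> neg_cycles N ?\<tau>"
    then obtain S where S: "X = {S}" "S \<in> components (pm N) E" "bar S = S"
      unfolding neg_cycles_def closed by blast
    have C: "nabs ` S \<in> \<C>" using nabs_components[OF S(2)] unfolding \<C>_def .
    have "S \<noteq> {}" using components_nonempty[OF S(2)] .
    then have "\<not> balanced \<pi> ?\<sigma> T (nabs ` S)" using balanced_iff[OF S(2)] S(3) by simp
    moreover have "above (nabs ` S) = {S}" using above_component[OF S(2)] S(3) by simp
    ultimately show "X \<in> above ` {C \<in> \<C>. \<not> balanced \<pi> ?\<sigma> T C}" using S(1) C by blast
  next
    fix X assume "X \<in> above ` {C \<in> \<C>. \<not> balanced \<pi> ?\<sigma> T C}"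
    then obtain C where C: "X = above C" "C \<in> \<C>" "\<not> balanced \<pi> ?\<sigma> T C" by blast
    obtain S where S: "S \<in> components (pm N) E" "nabs ` S = C" "above C = {S, bar S}"
        "bar S \<inter> S = {} \<or> bar S = S" using above_eq[OF C(2)[unfolded \<C>_def]] .
    then have "bar S = S" using balanced_iff[OF S(1)] C(3) by simp
    then have "X = {S}" using C(1) S(3) by simp
    then show "X \<in> neg_cycles N ?\<tau>" unfolding neg_cycles_def closed using S(1) \<open>bar S = S\<close> by blast
  qed
  have pos: "pos_cycles N ?\<tau> = above ` {C \<in> \<C>. balanced \<pi> ?\<sigma> T C}"
  proof (intro equalityI subsetI)
    fix X assume "X \<in> pos_cycles N ?\<tau>"
    then obtain S where S: "X = {S, bar S}" "S \<in> components (pm N) E" "bar S \<inter> S = {}"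
      unfolding pos_cycles_def closed by blast
    have C: "nabs ` S \<in> \<C>" using nabs_components[OF S(2)] unfolding \<C>_def .
    have "balanced \<pi> ?\<sigma> T (nabs ` S)" using balanced_iff[OF S(2)] S(3) by simp
    moreover have "above (nabs ` S) = {S, bar S}" using above_component[OF S(2)] .
    ultimately show "X \<in> above ` {C \<in> \<C>. balanced \<pi> ?\<sigma> T C}" using S(1) C by blast
  next
    fix X assume "X \<in> above ` {C \<in> \<C>. balanced \<pi> ?\<sigma> T C}"
    then obtain C where C: "X = above C" "C \<in> \<C>" "balanced \<pi> ?\<sigma> T C" by blast
    obtain S where S: "S \<in> components (pm N) E" "nabs ` S = C" "above C = {S, bar S}"
        using above_eq[OF C(2)[unfolded \<C>_def]] by metis
    then have "bar S \<inter> S = {}" using balanced_iff[OF S(1)] C(3) by simp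
    then show "X \<in> pos_cycles N ?\<tau>" unfolding pos_cycles_def closed using S(1,3) C(1) by blast
  qed
  have inj: "inj_on above \<C>" using above_inj unfolding \<C>_def .
  show "c_minus N ?\<tau> = card {C \<in> \<C>. \<not> balanced \<pi> ?\<sigma> T C}"
    unfolding c_minus_def neg by (rule card_image) (rule inj_on_subset[OF inj], blast)
  have Cyc: "Cyc N ?\<tau> = above ` \<C>" unfolding Cyc_def neg pos by blast
  have half: "card {B \<in> ?\<tau>. B \<subseteq> S} = card S div 2" if S: "S \<in> components (pm N) E" for S
    using card_component_matching[OF P2symD(1,2)[OF lift_in_P2sym[OF \<pi>, of T]] _ E_Union S]
    by (simp add: E_def)
  have len: "cycle_length N ?\<tau> (above C) = card C div 2" if C: "C \<in> \<C>" for C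
  proof -
    obtain S where S: "S \<in> components (pm N) E" "nabs ` S = C" "above C = {S, bar S}"
      using above_eq[OF C[unfolded \<C>_def]] by metis
    have "bar S \<in> components (pm N) E" using S(3) unfolding above_def by blast
    \<comment> \<open>Both members of \<open>above C\<close> give the same number of pairs, so the
      image under \<open>the_elem\<close> is indeed a singleton.\<close>
    moreover have "card (bar S) = card S" by (rule card_image) auto
    ultimately have "(\<lambda>S. card {B \<in> ?\<tau>. B \<subseteq> S}) ` above C = {card S div 2}"
      unfolding S(3) using half[OF S(1)] half[of "bar S"] by auto
    then have per: "pairs_per_component ?\<tau> (above C) = card S div 2"
      unfolding pairs_per_component_def pairs by simp
    have mem: "above C \<in> neg_cycles N ?\<tau> \<longleftrightarrow> \<not> balanced \<pi> ?\<sigma> T C"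
      unfolding neg using C inj_on_image_mem_iff[OF inj C, of "{C \<in> \<C>. \<not> balanced \<pi> ?\<sigma> T C}"] by blast
    show ?thesis
    proof (cases "balanced \<pi> ?\<sigma> T C")
      case True
      then have "card S = card C" using balanced_iff[OF S(1)] card_above(1)[OF S(1)] S(2) by simp
      then show ?thesis using mem True per by (simp add: cycle_length_def)
    next
      case False
      then have "bar S \<inter> S \<noteq> {}" using balanced_iff[OF S(1)] S(2) by simp
      then have "bar S = S"
        using disjointD[OF disjoint_components \<open>bar S \<in> components (pm N) E\<close> S(1)] by blast
      then have "card S = 2 * card C" using card_above(2)[OF S(1)] S(2) by simp
      then show ?thesis using mem False per by (simp add: cycle_length_def)
    qed
  qed
  have "l_c N ?\<tau> = (\<Sum>C\<in>\<C>. cycle_length N ?\<tau> (above C) - 1)"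
    unfolding l_c_def Cyc by (simp add: sum.reindex[OF inj])
  then show "l_c N ?\<tau> = (\<Sum>C\<in>\<C>. card C div 2 - 1)" using len by simp
qed

text \<open>For a fixed underlying matching with \<open>c\<close> cycles, the power of
  \<open>qp\<close> is the same for all signs and comes out of the sum. The factor
  \<open>2 ^ (n - c)\<close> from counting signs joins \<open>qp ^ (n - c)\<close>.\<close>

lemma sum_P2sym_eq_sum_P2:
  fixes qp qm :: real
  shows "(\<Sum>\<tau>\<in>P2sym (2 * n). qm ^ c_minus (2 * n) \<tau> * qp ^ l_c (2 * n) \<tau>) =
    (\<Sum>\<pi>\<in>P2 (2 * n). (1 + qm) ^ num_cycles (2 * n) \<pi> * (2 * qp) ^ (n - num_cycles (2 * n) \<pi>))"
  unfolding sum_P2sym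
proof (rule sum.cong[OF refl])
  fix \<pi> assume \<pi>: "\<pi> \<in> P2 (2 * n)"
  let ?\<sigma> = "hat_matching (2 * n) \<pi>"
  let ?\<C> = "components {1..2 * n} (\<pi> \<union> ?\<sigma>)"
  have \<sigma>: "?\<sigma> \<in> P2 (2 * n)" using hat_matching(1)[OF \<pi>] .
  have card: "card \<pi> = n" using card_matching[OF P2_partition[OF \<pi>] P2_card[OF \<pi>]] by simp
  note sums = sum_unbalanced[OF P2_partition[OF \<pi>] P2_card[OF \<pi>] P2_partition[OF \<sigma>] P2_card[OF \<sigma>], simplified card]
  have "(\<Sum>T\<in>Pow \<pi>. qm ^ c_minus (2 * n) (lift \<pi> T) * qp ^ l_c (2 * n) (lift \<pi> T)) =
     (\<Sum>T\<in>Pow \<pi>. qm ^ card {C \<in> ?\<C>. \<not> balanced \<pi> ?\<sigma> T C}) * qp ^ (n - card ?\<C>)"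
    unfolding cycles_lift[OF \<pi>] using sums(2) by (simp add: sum_distrib_right)
  also have "\<dots> = (1 + qm) ^ card ?\<C> * (2 * qp) ^ (n - card ?\<C>)"
    using sums(1)[of qm] by (simp add: power_mult_distrib)
  finally show "(\<Sum>T\<in>Pow \<pi>. qm ^ c_minus (2 * n) (lift \<pi> T) * qp ^ l_c (2 * n) (lift \<pi> T)) =
     (1 + qm) ^ num_cycles (2 * n) \<pi> * (2 * qp) ^ (n - num_cycles (2 * n) \<pi>)"
    by (simp add: num_cycles_def)
qed

theorem proposition4p19:
  fixes qp qm x y :: real and \<mu> :: "real measure" and n :: nat
  assumes params:
    "(\<exists>(M::nat) (N::nat) (\<epsilon>::real). M + N \<noteq> 0 \<and> \<epsilon> \<in> {1, -1} \<and>
        qp = \<epsilon> / (real M + real N) \<and> qm = (real M - real N) / (real M + real N))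
     \<or> (qp = 0 \<and> -1 \<le> qm \<and> qm \<le> 1)"
    and mu: "is_mu qp qm \<mu>"
    and x: "x = 1 + qm" and y: "y = 2 * qp"
  shows "moment \<mu> (2 * n) = (\<Sum>\<pi>\<in>P2sym (2 * n). qm ^ c_minus (2 * n) \<pi> * qp ^ l_c (2 * n) \<pi>)
       \<and> (\<Sum>\<pi>\<in>P2sym (2 * n). qm ^ c_minus (2 * n) \<pi> * qp ^ l_c (2 * n) \<pi>)
         = (\<Sum>\<pi>\<in>P2 (2 * n). x ^ num_cycles (2 * n) \<pi> * y ^ (n - num_cycles (2 * n) \<pi>))"
proof
  define w where "w k = (if k = 0 then 0 else lam qp qm k)" for k
  \<comment> \<open>Starting height 0 means integrating against the constant polynomial 1, which
    gives the plain moment.\<close>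
  have "moment \<mu> (2 * n) = ballot_sum w 0 {1..2 * n}"
    using is_mu_integral_power_Qpoly[OF mu, of "{1..2 * n}" 0] unfolding w_def moment_def by simp
  also have "\<dots> = (\<Sum>\<pi>\<in>P2 (2 * n). x ^ num_cycles (2 * n) \<pi> * y ^ (n - num_cycles (2 * n) \<pi>))"
    by (rule sum_P2_eq_ballot_sum[symmetric]) (auto simp: w_def lam_def x y)
  also note sum_P2sym_eq_sum_P2[of qm n qp, folded x y, symmetric]
  finally show "moment \<mu> (2 * n) =
    (\<Sum>\<pi>\<in>P2sym (2 * n). qm ^ c_minus (2 * n) \<pi> * qp ^ l_c (2 * n) \<pi>)" .
  show "(\<Sum>\<pi>\<in>P2sym (2 * n). qm ^ c_minus (2 * n) \<pi> * qp ^ l_c (2 * n) \<pi>)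
         = (\<Sum>\<pi>\<in>P2 (2 * n). x ^ num_cycles (2 * n) \<pi> * y ^ (n - num_cycles (2 * n) \<pi>))"
    unfolding x y by (rule sum_P2sym_eq_sum_P2)
qed

end
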